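(* A $5$-dimensional Einstein-Sasaki (spin) manifold $(M,g,\xi,\eta,\varphi)$ endowed with its characteristic connection cannot admit (nontrivial) Killing spinors with torsion.
   Context: For a 5-dimensional Einstein-Sasaki manifold (normalized so that $\mathrm{Ric}^g=4g$, $\mathrm{Scal}^g=20$) there is a local orthonormal frame with $\xi\cong\eta=e_5$ and $d\eta=2(e_1\wedge e_2+e_3\wedge e_4)$. The characteristic connection $\nabla^c$ is the unique metric connection with totally skew-symmetric torsion preserving the Sasakian structure; its torsion 3-form is $T=\eta\wedge d\eta=2(e_1\wedge e_2+e_3\wedge e_4)\wedge e_5$, and $\nabla^cT=0$. On spinors (Clifford convention $X\cdot X=-g(X,X)$, forms acting by $e_{i_1}\wedge\dots\wedge e_{i_k}\mapsto e_{i_1}\cdots e_{i_k}$) put $\nabla^s_X\psi=\nabla^g_X\psi+s(X\lrcorner T)\cdot\psi$, so $\nabla^c=\nabla^{1/4}$. A Killing spinor with torsion on an $n$-dimensional manifold is a spinor field satisfying $\nabla^s_X\psi=\kappa X\cdot\psi$ for all $X$, for some constant $\kappa$, with $s=\frac{n-1}{4(n-3)}$; for $n=5$ this is $s=\frac12$. *)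

theory Defs
  imports "HOL-Analysis.Analysis"
begin

text \<open>
  Smooth manifolds carrying tensor fields and spinor fields, in the classical chart-wise style:
  a field is a family of components, one function for each chart of an atlas, defined on the
  coordinate image of the chart and subject to the transformation law on overlaps.  The values of
  the component functions outside the coordinate image are irrelevant.
\<close>

section \<open>Smooth maps and atlases\<close>

text \<open>Only meaningful for open \<open>S\<close>.\<close>

primrec Ck_on :: "nat \<Rightarrow> 'a::euclidean_space set \<Rightarrow> ('a \<Rightarrow> 'b::real_normed_vector) \<Rightarrow> bool" where
  "Ck_on 0 S f \<longleftrightarrow> continuous_on S f"
| "Ck_on (Suc k) S f \<longleftrightarrow>
     (\<forall>x\<in>S. f differentiable (at x)) \<and> (\<forall>v. Ck_on k S (\<lambda>x. frechet_derivative f (at x) v))"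

definition smooth_on :: "'a::euclidean_space set \<Rightarrow> ('a \<Rightarrow> 'b::real_normed_vector) \<Rightarrow> bool" where
  "smooth_on S f \<longleftrightarrow> (\<forall>k. Ck_on k S f)"

text \<open>A chart is a domain together with a coordinate map.\<close>

type_synonym ('m, 'n) chart = "'m set \<times> ('m \<Rightarrow> real^'n)"

definition coords :: "('m, 'n::finite) chart \<Rightarrow> (real^'n) set" where
  "coords c = snd c ` fst c"

definition overlap :: "('m, 'n::finite) chart \<Rightarrow> ('m, 'n) chart \<Rightarrow> (real^'n) set" where
  "overlap c d = snd c ` (fst c \<inter> fst d)"

definition transition :: "('m, 'n::finite) chart \<Rightarrow> ('m, 'n) chart \<Rightarrow> real^'n \<Rightarrow> real^'n" where
  "transition c d = snd d \<circ> inv_into (fst c) (snd c)"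

definition jacobian :: "('m, 'n::finite) chart \<Rightarrow> ('m, 'n) chart \<Rightarrow> real^'n \<Rightarrow> real^'n \<Rightarrow> real^'n" where
  "jacobian c d x = frechet_derivative (transition c d) (at x)"

definition smooth_atlas ::
  "('m::{t2_space, second_countable_topology}, 'n::finite) chart set \<Rightarrow> bool" where
  "smooth_atlas A \<longleftrightarrow>
     (\<Union>c\<in>A. fst c) = UNIV \<and>
     (\<forall>c\<in>A. open (fst c) \<and> open (coords c) \<and>
        homeomorphism (fst c) (coords c) (snd c) (inv_into (fst c) (snd c))) \<and>
     (\<forall>c\<in>A. \<forall>d\<in>A. smooth_on (overlap c d) (transition c d))"

section \<open>Tensor fields\<close>

type_synonym ('m, 'n) vfield = "('m, 'n) chart \<Rightarrow> real^'n \<Rightarrow> real^'n"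
type_synonym ('m, 'n) form1 = "('m, 'n) chart \<Rightarrow> real^'n \<Rightarrow> real^'n \<Rightarrow> real"
type_synonym ('m, 'n) endo = "('m, 'n) chart \<Rightarrow> real^'n \<Rightarrow> real^'n \<Rightarrow> real^'n"
type_synonym ('m, 'n) form2 = "('m, 'n) chart \<Rightarrow> real^'n \<Rightarrow> real^'n \<Rightarrow> real^'n \<Rightarrow> real"

definition vector_field :: "('m, 'n::finite) chart set \<Rightarrow> ('m, 'n) vfield \<Rightarrow> bool" where
  "vector_field A X \<longleftrightarrow>
     (\<forall>c\<in>A. smooth_on (coords c) (X c)) \<and>
     (\<forall>c\<in>A. \<forall>d\<in>A. \<forall>x\<in>overlap c d. X d (transition c d x) = jacobian c d x (X c x))"

definition one_form :: "('m, 'n::finite) chart set \<Rightarrow> ('m, 'n) form1 \<Rightarrow> bool" where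
  "one_form A \<eta> \<longleftrightarrow>
     (\<forall>c\<in>A. (\<forall>x\<in>coords c. linear (\<eta> c x)) \<and> (\<forall>v. smooth_on (coords c) (\<lambda>x. \<eta> c x v))) \<and>
     (\<forall>c\<in>A. \<forall>d\<in>A. \<forall>x\<in>overlap c d. \<forall>v.
        \<eta> d (transition c d x) (jacobian c d x v) = \<eta> c x v)"

definition endo_field :: "('m, 'n::finite) chart set \<Rightarrow> ('m, 'n) endo \<Rightarrow> bool" where
  "endo_field A \<phi> \<longleftrightarrow>
     (\<forall>c\<in>A. (\<forall>x\<in>coords c. linear (\<phi> c x)) \<and> (\<forall>v. smooth_on (coords c) (\<lambda>x. \<phi> c x v))) \<and>
     (\<forall>c\<in>A. \<forall>d\<in>A. \<forall>x\<in>overlap c d. \<forall>v.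
        \<phi> d (transition c d x) (jacobian c d x v) = jacobian c d x (\<phi> c x v))"

definition riemannian_metric :: "('m, 'n::finite) chart set \<Rightarrow> ('m, 'n) form2 \<Rightarrow> bool" where
  "riemannian_metric A g \<longleftrightarrow>
     (\<forall>c\<in>A. (\<forall>x\<in>coords c. bilinear (g c x) \<and> (\<forall>u v. g c x u v = g c x v u) \<and>
               (\<forall>u. u \<noteq> 0 \<longrightarrow> g c x u u > 0)) \<and>
            (\<forall>u v. smooth_on (coords c) (\<lambda>x. g c x u v))) \<and>
     (\<forall>c\<in>A. \<forall>d\<in>A. \<forall>x\<in>overlap c d. \<forall>u v.
        g d (transition c d x) (jacobian c d x u) (jacobian c d x v) = g c x u v)"

section \<open>Affine connections\<close>

text \<open>
  A connection is given by its Christoffel map \<open>D c x u v = \<nabla>\<^sub>u v\<close>, with \<open>v\<close> extended as a constant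
  (coordinate) vector field; hence the inhomogeneous transformation law.
\<close>

type_synonym ('m, 'n) connection = "('m, 'n) chart \<Rightarrow> real^'n \<Rightarrow> real^'n \<Rightarrow> real^'n \<Rightarrow> real^'n"

definition affine_connection :: "('m, 'n::finite) chart set \<Rightarrow> ('m, 'n) connection \<Rightarrow> bool" where
  "affine_connection A D \<longleftrightarrow>
     (\<forall>c\<in>A. (\<forall>x\<in>coords c. bilinear (D c x)) \<and> (\<forall>u v. smooth_on (coords c) (\<lambda>x. D c x u v))) \<and>
     (\<forall>c\<in>A. \<forall>d\<in>A. \<forall>x\<in>overlap c d. \<forall>u v.
        frechet_derivative (\<lambda>y. jacobian c d y v) (at x) u
          + D d (transition c d x) (jacobian c d x u) (jacobian c d x v)
        = jacobian c d x (D c x u v))"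

text \<open>
  Covariant derivatives in the direction \<open>u\<close>, in one chart, of a vector field \<open>Y\<close>, a 1-form \<open>\<eta>\<close>
  and an endomorphism field \<open>\<phi>\<close>; \<open>G\<close> is the Christoffel map in that chart.
\<close>

definition nabla_vec ::
  "(real^'n \<Rightarrow> real^'n \<Rightarrow> real^'n \<Rightarrow> real^'n) \<Rightarrow> (real^'n \<Rightarrow> real^'n) \<Rightarrow> real^'n \<Rightarrow> real^'n \<Rightarrow> real^'n::finite" where
  "nabla_vec G Y x u = frechet_derivative Y (at x) u + G x u (Y x)"

definition nabla_form ::
  "(real^'n \<Rightarrow> real^'n \<Rightarrow> real^'n \<Rightarrow> real^'n::finite) \<Rightarrow> (real^'n \<Rightarrow> real^'n \<Rightarrow> real) \<Rightarrow>
   real^'n \<Rightarrow> real^'n \<Rightarrow> real^'n \<Rightarrow> real" where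
  "nabla_form G \<eta> x u v = frechet_derivative (\<lambda>y. \<eta> y v) (at x) u - \<eta> x (G x u v)"

definition nabla_endo ::
  "(real^'n \<Rightarrow> real^'n \<Rightarrow> real^'n \<Rightarrow> real^'n::finite) \<Rightarrow> (real^'n \<Rightarrow> real^'n \<Rightarrow> real^'n) \<Rightarrow>
   real^'n \<Rightarrow> real^'n \<Rightarrow> real^'n \<Rightarrow> real^'n" where
  "nabla_endo G \<phi> x u v =
     frechet_derivative (\<lambda>y. \<phi> y v) (at x) u + G x u (\<phi> x v) - \<phi> x (G x u v)"

definition metric_connection ::
  "('m, 'n::finite) chart set \<Rightarrow> ('m, 'n) form2 \<Rightarrow> ('m, 'n) connection \<Rightarrow> bool" where
  "metric_connection A g D \<longleftrightarrow> affine_connection A D \<and>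
     (\<forall>c\<in>A. \<forall>x\<in>coords c. \<forall>u v w.
        frechet_derivative (\<lambda>y. g c y v w) (at x) u = g c x (D c x u v) w + g c x v (D c x u w))"

text \<open>No bracket term occurs in the torsion, since coordinate vector fields commute.\<close>

definition torsion ::
  "('m, 'n::finite) connection \<Rightarrow> ('m, 'n) chart \<Rightarrow> real^'n \<Rightarrow> real^'n \<Rightarrow> real^'n \<Rightarrow> real^'n" where
  "torsion D c x u v = D c x u v - D c x v u"

definition torsion_form ::
  "('m, 'n::finite) form2 \<Rightarrow> ('m, 'n) connection \<Rightarrow> ('m, 'n) chart \<Rightarrow>
   real^'n \<Rightarrow> real^'n \<Rightarrow> real^'n \<Rightarrow> real^'n \<Rightarrow> real" where
  "torsion_form g D c x u v w = g c x (torsion D c x u v) w"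

definition levi_civita ::
  "('m, 'n::finite) chart set \<Rightarrow> ('m, 'n) form2 \<Rightarrow> ('m, 'n) connection \<Rightarrow> bool" where
  "levi_civita A g D \<longleftrightarrow> metric_connection A g D \<and>
     (\<forall>c\<in>A. \<forall>x\<in>coords c. \<forall>u v. torsion D c x u v = 0)"

definition skew_torsion ::
  "('m, 'n::finite) chart set \<Rightarrow> ('m, 'n) form2 \<Rightarrow> ('m, 'n) connection \<Rightarrow> bool" where
  "skew_torsion A g D \<longleftrightarrow>
     (\<forall>c\<in>A. \<forall>x\<in>coords c. \<forall>u v w.
        torsion_form g D c x v u w = - torsion_form g D c x u v w \<and>
        torsion_form g D c x u w v = - torsion_form g D c x u v w)"

text \<open>\<open>curvature D c x u v w = R(u,v)w\<close> with \<open>R(u,v) = [\<nabla>\<^sub>u, \<nabla>\<^sub>v] - \<nabla>\<^bsub>[u,v]\<^esub>\<close>.\<close>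

definition curvature ::
  "('m, 'n::finite) connection \<Rightarrow> ('m, 'n) chart \<Rightarrow>
   real^'n \<Rightarrow> real^'n \<Rightarrow> real^'n \<Rightarrow> real^'n \<Rightarrow> real^'n" where
  "curvature D c x u v w =
     nabla_vec (D c) (\<lambda>y. D c y v w) x u - nabla_vec (D c) (\<lambda>y. D c y u w) x v"

text \<open>\<open>Ric(v,w)\<close> is the trace of \<open>u \<mapsto> R(u,v)w\<close>.\<close>

definition ricci ::
  "('m, 'n::finite) connection \<Rightarrow> ('m, 'n) chart \<Rightarrow> real^'n \<Rightarrow> real^'n \<Rightarrow> real^'n \<Rightarrow> real" where
  "ricci D c x v w = (\<Sum>i\<in>UNIV. curvature D c x (axis i 1) v w $ i)"

text \<open>Here \<open>D\<close> is meant to be the Levi-Civita connection of \<open>g\<close>.\<close>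

definition einstein_metric ::
  "('m, 'n::finite) chart set \<Rightarrow> ('m, 'n) form2 \<Rightarrow> ('m, 'n) connection \<Rightarrow> real \<Rightarrow> bool" where
  "einstein_metric A g D lam \<longleftrightarrow>
     (\<forall>c\<in>A. \<forall>x\<in>coords c. \<forall>v w. ricci D c x v w = lam * g c x v w)"

section \<open>Sasakian structures\<close>

definition ext_deriv ::
  "(real^'n \<Rightarrow> real^'n \<Rightarrow> real) \<Rightarrow> real^'n \<Rightarrow> real^'n \<Rightarrow> real^'n::finite \<Rightarrow> real" where
  "ext_deriv \<eta> x u v =
     frechet_derivative (\<lambda>y. \<eta> y v) (at x) u - frechet_derivative (\<lambda>y. \<eta> y u) (at x) v"

definition lie_bracket ::
  "(real^'n \<Rightarrow> real^'n) \<Rightarrow> (real^'n \<Rightarrow> real^'n) \<Rightarrow> real^'n \<Rightarrow> real^'n::finite" where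
  "lie_bracket X Y x = frechet_derivative Y (at x) (X x) - frechet_derivative X (at x) (Y x)"

text \<open>
  The Nijenhuis tensor \<open>[\<phi>,\<phi>](u,v) = [\<phi>u,\<phi>v] - \<phi>[\<phi>u,v] - \<phi>[u,\<phi>v] + \<phi>\<^sup>2[u,v]\<close>, evaluated on
  coordinate vector fields, for which \<open>[u,v] = 0\<close>.
\<close>

definition nijenhuis ::
  "(real^'n \<Rightarrow> real^'n \<Rightarrow> real^'n) \<Rightarrow> real^'n \<Rightarrow> real^'n \<Rightarrow> real^'n \<Rightarrow> real^'n::finite" where
  "nijenhuis \<phi> x u v =
     lie_bracket (\<lambda>y. \<phi> y u) (\<lambda>y. \<phi> y v) x
     - \<phi> x (lie_bracket (\<lambda>y. \<phi> y u) (\<lambda>y. v) x)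
     - \<phi> x (lie_bracket (\<lambda>y. u) (\<lambda>y. \<phi> y v) x)"

text \<open>
  A Sasakian structure is a normal contact metric structure.  The exterior derivative is
  normalised without a factor 1/2, as in \<open>d\<eta> = 2 (e\<^sub>1 \<and> e\<^sub>2 + e\<^sub>3 \<and> e\<^sub>4)\<close>, so the normality condition
  reads \<open>[\<phi>,\<phi>] + d\<eta> \<otimes> \<xi> = 0\<close> and the contact metric condition \<open>d\<eta>(u,v) = 2 g(u,\<phi>v)\<close>.
\<close>

definition sasakian ::
  "('m, 'n::finite) chart set \<Rightarrow> ('m, 'n) form2 \<Rightarrow> ('m, 'n) vfield \<Rightarrow> ('m, 'n) form1 \<Rightarrow>
   ('m, 'n) endo \<Rightarrow> bool" where
  "sasakian A g \<xi> \<eta> \<phi> \<longleftrightarrow>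
     riemannian_metric A g \<and> vector_field A \<xi> \<and> one_form A \<eta> \<and> endo_field A \<phi> \<and>
     (\<forall>c\<in>A. \<forall>x\<in>coords c.
        \<eta> c x (\<xi> c x) = 1 \<and>
        (\<forall>u. \<phi> c x (\<phi> c x u) = - u + \<eta> c x u *\<^sub>R \<xi> c x) \<and>
        (\<forall>u v. g c x (\<phi> c x u) (\<phi> c x v) = g c x u v - \<eta> c x u * \<eta> c x v) \<and>
        (\<forall>u v. ext_deriv (\<eta> c) x u v = 2 * g c x u (\<phi> c x v)) \<and>
        (\<forall>u v. nijenhuis (\<phi> c) x u v + ext_deriv (\<eta> c) x u v *\<^sub>R \<xi> c x = 0))"

text \<open>
  The metric connection with totally skew-symmetric torsion that preserves the Sasakian structure.
  Such a connection exists and is unique; its torsion form is \<open>\<eta> \<and> d\<eta>\<close>.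
\<close>

definition characteristic_connection ::
  "('m, 'n::finite) chart set \<Rightarrow> ('m, 'n) form2 \<Rightarrow> ('m, 'n) vfield \<Rightarrow> ('m, 'n) form1 \<Rightarrow>
   ('m, 'n) endo \<Rightarrow> ('m, 'n) connection \<Rightarrow> bool" where
  "characteristic_connection A g \<xi> \<eta> \<phi> D \<longleftrightarrow>
     metric_connection A g D \<and> skew_torsion A g D \<and>
     (\<forall>c\<in>A. \<forall>x\<in>coords c. \<forall>u.
        nabla_vec (D c) (\<xi> c) x u = 0 \<and>
        (\<forall>v. nabla_form (D c) (\<eta> c) x u v = 0) \<and>
        (\<forall>v. nabla_endo (D c) (\<phi> c) x u v = 0))"

section \<open>Spinors\<close>

text \<open>
  A spinor module: a complex representation of the Clifford algebra of Euclidean \<open>\<real>\<^sup>n\<close>, with the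
  convention \<open>v \<cdot> v = - |v|\<^sup>2\<close>, on \<open>\<complex>\<^sup>N\<close> where \<open>N = 2\<^bsup>[n/2]\<^esup>\<close> (hence irreducible).
\<close>

definition spinor_module :: "('n::finite \<Rightarrow> complex^'s^'s::finite) \<Rightarrow> bool" where
  "spinor_module \<gamma> \<longleftrightarrow> CARD('s) = 2 ^ (CARD('n) div 2) \<and>
     (\<forall>i j. \<gamma> i ** \<gamma> j + \<gamma> j ** \<gamma> i = (if i = j then mat (-2) else 0))"

definition cliff :: "('n::finite \<Rightarrow> complex^'s^'s) \<Rightarrow> real^'n \<Rightarrow> complex^'s^'s::finite" where
  "cliff \<gamma> v = (\<Sum>i\<in>UNIV. (v $ i) *\<^sub>R \<gamma> i)"

text \<open>
  The spin group as a subgroup of the invertible elements of the endomorphism ring of the spinor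
  module (on which it acts faithfully): products of an even number of unit vectors.
\<close>

definition spin_group :: "('n::finite \<Rightarrow> complex^'s^'s) \<Rightarrow> (complex^'s^'s::finite) set" where
  "spin_group \<gamma> =
     {foldr (\<lambda>v M. cliff \<gamma> v ** M) vs (mat 1) | vs. even (length vs) \<and> (\<forall>v\<in>set vs. norm v = 1)}"

type_synonym ('m, 'n) frame = "('m, 'n) chart \<Rightarrow> real^'n \<Rightarrow> 'n \<Rightarrow> real^'n"

text \<open>
  A spin structure in terms of local sections of the spin frame bundle.  The charts of the atlas
  are taken small enough for the spin frame bundle to have a section over each of them, which
  every spin structure permits after shrinking charts.  \<open>E c\<close> is the orthonormal frame underlying
  the section over the chart \<open>c\<close>, and \<open>S c d\<close>, a function of the \<open>c\<close>-coordinates, is the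
  \<open>Spin(n)\<close>-valued change from section \<open>c\<close> to section \<open>d\<close>.  If \<open>h\<close> is the change of frames, taking
  the components of a tangent vector in the frame \<open>E c\<close> to those in the frame \<open>E d\<close>, then \<open>S c d\<close>
  lies over \<open>h\<close> under the double cover \<open>Spin(n) \<rightarrow> SO(n)\<close>: \<open>S \<cdot> v \<cdot> S\<inverse> = h v\<close>.  In particular
  the frames \<open>E c\<close> define an orientation.
\<close>

definition spin_structure ::
  "('m, 'n::finite) chart set \<Rightarrow> ('m, 'n) form2 \<Rightarrow> ('n \<Rightarrow> complex^'s^'s::finite) \<Rightarrow> ('m, 'n) frame \<Rightarrow>
   (('m, 'n) chart \<Rightarrow> ('m, 'n) chart \<Rightarrow> real^'n \<Rightarrow> complex^'s^'s) \<Rightarrow> bool" where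
  "spin_structure A g \<gamma> E S \<longleftrightarrow>
     (\<forall>c\<in>A. (\<forall>i. smooth_on (coords c) (\<lambda>x. E c x i)) \<and>
        (\<forall>x\<in>coords c. \<forall>i j. g c x (E c x i) (E c x j) = (if i = j then 1 else 0))) \<and>
     (\<forall>c\<in>A. \<forall>d\<in>A. smooth_on (overlap c d) (S c d) \<and>
        (\<forall>x\<in>overlap c d. S c d x \<in> spin_group \<gamma> \<and>
           (\<forall>v w. jacobian c d x (\<Sum>i\<in>UNIV. (v $ i) *\<^sub>R E c x i)
                    = (\<Sum>i\<in>UNIV. (w $ i) *\<^sub>R E d (transition c d x) i) \<longrightarrow>
                  S c d x ** cliff \<gamma> v = cliff \<gamma> w ** S c d x))) \<and>
     (\<forall>c\<in>A. \<forall>d\<in>A. \<forall>e\<in>A. \<forall>x \<in> snd c ` (fst c \<inter> fst d \<inter> fst e).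
        S c e x = S d e (transition c d x) ** S c d x)"

type_synonym ('m, 'n, 's) spinor = "('m, 'n) chart \<Rightarrow> real^'n \<Rightarrow> complex^'s"

definition spinor_field ::
  "('m, 'n::finite) chart set \<Rightarrow>
   (('m, 'n) chart \<Rightarrow> ('m, 'n) chart \<Rightarrow> real^'n \<Rightarrow> complex^'s^'s::finite) \<Rightarrow>
   ('m, 'n, 's) spinor \<Rightarrow> bool" where
  "spinor_field A S \<psi> \<longleftrightarrow>
     (\<forall>c\<in>A. smooth_on (coords c) (\<psi> c)) \<and>
     (\<forall>c\<in>A. \<forall>d\<in>A. \<forall>x\<in>overlap c d. \<psi> d (transition c d x) = S c d x *v \<psi> c x)"

text \<open>
  The Levi-Civita spin connection
  \<open>\<nabla>\<^sub>u \<psi> = u(\<psi>) + 1/2 \<Sum>\<^bsub>i<j\<^esub> g(\<nabla>\<^sub>u e\<^sub>i, e\<^sub>j) e\<^sub>i \<cdot> e\<^sub>j \<cdot> \<psi>\<close>; the summand is symmetric in \<open>i,j\<close> and vanishes for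
  \<open>i = j\<close>, so the sum is taken over all pairs.
\<close>

definition spin_nabla ::
  "('m, 'n::finite) form2 \<Rightarrow> ('m, 'n) connection \<Rightarrow> ('n \<Rightarrow> complex^'s^'s::finite) \<Rightarrow> ('m, 'n) frame \<Rightarrow>
   ('m, 'n, 's) spinor \<Rightarrow> ('m, 'n) chart \<Rightarrow> real^'n \<Rightarrow> real^'n \<Rightarrow> complex^'s" where
  "spin_nabla g D \<gamma> E \<psi> c x u =
     frechet_derivative (\<psi> c) (at x) u
     + ((1/4) *\<^sub>R (\<Sum>i\<in>UNIV. \<Sum>j\<in>UNIV.
          g c x (nabla_vec (D c) (\<lambda>y. E c y i) x u) (E c x j) *\<^sub>R (\<gamma> i ** \<gamma> j))) *v \<psi> c x"

text \<open>The Clifford action \<open>\<Sum>\<^bsub>i<j\<^esub> \<beta>(e\<^sub>i, e\<^sub>j) e\<^sub>i \<cdot> e\<^sub>j\<close> of a 2-form, as a sum over all pairs.\<close>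

definition cliff2 ::
  "('n::finite \<Rightarrow> complex^'s^'s::finite) \<Rightarrow> ('n \<Rightarrow> real^'n) \<Rightarrow> (real^'n \<Rightarrow> real^'n \<Rightarrow> real) \<Rightarrow> complex^'s^'s" where
  "cliff2 \<gamma> e \<beta> = (1/2) *\<^sub>R (\<Sum>i\<in>UNIV. \<Sum>j\<in>UNIV. \<beta> (e i) (e j) *\<^sub>R (\<gamma> i ** \<gamma> j))"

text \<open>
  \<open>\<nabla>\<^sup>s\<^sub>u \<psi> = \<nabla>\<^sup>g\<^sub>u \<psi> + s (u \<lrcorner> T) \<cdot> \<psi>\<close>, where \<open>LC\<close> is the Levi-Civita connection and \<open>T\<close> is the
  torsion form of \<open>D\<close>.
\<close>

definition spin_nabla_torsion ::
  "real \<Rightarrow> ('m, 'n::finite) form2 \<Rightarrow> ('m, 'n) connection \<Rightarrow> ('m, 'n) connection \<Rightarrow>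
   ('n \<Rightarrow> complex^'s^'s::finite) \<Rightarrow> ('m, 'n) frame \<Rightarrow>
   ('m, 'n, 's) spinor \<Rightarrow> ('m, 'n) chart \<Rightarrow> real^'n \<Rightarrow> real^'n \<Rightarrow> complex^'s" where
  "spin_nabla_torsion s g LC D \<gamma> E \<psi> c x u =
     spin_nabla g LC \<gamma> E \<psi> c x u
     + s *\<^sub>R (cliff2 \<gamma> (E c x) (torsion_form g D c x u) *v \<psi> c x)"

definition killing_spinor_with_torsion ::
  "('m, 'n::finite) chart set \<Rightarrow> ('m, 'n) form2 \<Rightarrow> ('m, 'n) connection \<Rightarrow> ('m, 'n) connection \<Rightarrow>
   ('n \<Rightarrow> complex^'s^'s::finite) \<Rightarrow> ('m, 'n) frame \<Rightarrow>
   (('m, 'n) chart \<Rightarrow> ('m, 'n) chart \<Rightarrow> real^'n \<Rightarrow> complex^'s^'s) \<Rightarrow>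
   ('m, 'n, 's) spinor \<Rightarrow> bool" where
  "killing_spinor_with_torsion A g LC D \<gamma> E S \<psi> \<longleftrightarrow>
     spinor_field A S \<psi> \<and>
     (\<exists>\<kappa>::complex. \<forall>c\<in>A. \<forall>x\<in>coords c. \<forall>u.
        spin_nabla_torsion ((real CARD('n) - 1) / (4 * (real CARD('n) - 3))) g LC D \<gamma> E \<psi> c x u
        = \<kappa> *s (cliff \<gamma> (\<chi> i. g c x u (E c x i)) *v \<psi> c x))"

end

theory Submission
  imports Defs
begin

text \<open>
  Since \<open>\<nabla>\<^sup>c = \<nabla>\<^sup>g + T/2\<close>, the spinor derivative \<open>\<nabla>\<^sup>s\<close> with \<open>s = 1/2\<close> is induced by the metric connection
  \<open>D' = \<nabla>\<^sup>g + T = \<nabla>\<^sup>c + T/2\<close>, whose torsion is \<open>2 T\<close>.  Differentiating \<open>\<nabla>\<^sup>s\<^sub>u \<psi> = \<kappa> u \<psi>\<close> once more gives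
  \<open>R'(u,v) \<psi> = 2 \<kappa> T(u,v) \<psi> + \<kappa>\<^sup>2 (v u - u v) \<psi>\<close>.  The torsion is \<open>T = \<eta> \<and> d\<eta>\<close>, which is parallel for
  \<open>\<nabla>\<^sup>c\<close>; so \<open>R'\<close>, \<open>R\<^sup>c\<close> and \<open>R\<^sup>g\<close> differ by terms quadratic in \<open>T\<close>, and \<open>R\<^sup>c\<close> is symmetric in pairs, kills \<open>\<xi>\<close> and
  commutes with \<open>\<phi>\<close>.  In an adapted frame \<open>e\<^sub>1, \<dots>, e\<^sub>5 = \<xi>\<close> the equations for \<open>(\<xi>, e\<^sub>1)\<close> and \<open>(\<xi>, e\<^sub>3)\<close> read
  \<open>4 \<kappa> e\<^sub>1 e\<^sub>2 \<psi> = 4 \<kappa> e\<^sub>3 e\<^sub>4 \<psi> = (2 \<kappa>\<^sup>2 + 3/2) e\<^sub>5 \<psi>\<close>, hence \<open>e\<^sub>1 e\<^sub>2 \<psi> = e\<^sub>3 e\<^sub>4 \<psi>\<close>.  The equation for \<open>(e\<^sub>3, e\<^sub>4)\<close> then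
  says \<open>R\<^sup>c(e\<^sub>3,e\<^sub>4) \<psi> = - e\<^sub>3 e\<^sub>4 \<psi>\<close>, whereas the Bianchi identity and the Einstein equation give
  \<open>R\<^sup>c(e\<^sub>3,e\<^sub>4) \<psi> = e\<^sub>3 e\<^sub>4 \<psi>\<close>; therefore \<open>\<psi> = 0\<close>.
\<close>

section \<open>Symmetry of second derivatives and the Leibniz rule\<close>

text \<open>The mean value theorem is applied to \<open>s \<mapsto> f (x + s u + t v) - f (x + s u)\<close> on \<open>[0, t]\<close>.\<close>

lemma second_difference_limit:
  fixes f :: "'a::euclidean_space \<Rightarrow> real"
  assumes U: "open U" "x \<in> U"
    and df: "\<And>y. y \<in> U \<Longrightarrow> f differentiable (at y)"
    and d2: "(\<lambda>y. frechet_derivative f (at y) u) differentiable (at x)"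
  shows "((\<lambda>t. (f (x + t *\<^sub>R u + t *\<^sub>R v) - f (x + t *\<^sub>R u) - f (x + t *\<^sub>R v) + f x) / t\<^sup>2)
           \<longlongrightarrow> frechet_derivative (\<lambda>y. frechet_derivative f (at y) u) (at x) v) (at_right 0)"
proof -
  define fu where "fu = (\<lambda>y. frechet_derivative f (at y) u)"
  define L where "L = frechet_derivative fu (at x)"
  \<comment> \<open>The parallelogram spanned by \<open>t *\<^sub>R u\<close> and
    \<open>t *\<^sub>R v\<close> at \<open>x\<close> stays within \<open>t * r\<close> of
    \<open>x\<close>; the summand 1 keeps \<open>r\<close> positive when both vectors
    vanish.\<close>
  define r where "r = norm u + norm v + 1"
  have rpos: "r > 0" unfolding r_def by (simp add: add_nonneg_pos)
  have fuL: "(fu has_derivative L) (at x)"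
    using d2 unfolding fu_def L_def by (simp add: frechet_derivative_works)
  then have linL: "linear L" by (rule has_derivative_linear)
  obtain d0 where d0: "d0 > 0" "ball x d0 \<subseteq> U"
    using U open_contains_ball by blast
  have step: "\<exists>d>0. \<forall>t. 0 < t \<longrightarrow> t < d \<longrightarrow>
      \<bar>(f (x + t *\<^sub>R u + t *\<^sub>R v) - f (x + t *\<^sub>R u) - f (x + t *\<^sub>R v) + f x) / t\<^sup>2 - L v\<bar> \<le> e"
    if e: "e > 0" for e :: real
  proof -
    \<comment> \<open>The first-order expansion of \<open>fu\<close> is used at two points, each
      with error at most \<open>e' * (t * r)\<close>; with this choice the two errors add up to
      \<open>e * t\<close>.\<close>
    define e' where "e' = e / (2 * r)"
    have e': "e' > 0" using e rpos by (simp add: e'_def)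
    obtain d1 where d1: "d1 > 0"
      "\<And>y. norm (y - x) < d1 \<Longrightarrow> norm (fu y - fu x - L (y - x)) \<le> e' * norm (y - x)"
      using fuL e' unfolding has_derivative_at_alt by blast
    define d where "d = min d0 d1 / r"
    have "d > 0" using d0 d1 rpos by (simp add: d_def)
    moreover have "\<bar>(f (x + t *\<^sub>R u + t *\<^sub>R v) - f (x + t *\<^sub>R u) - f (x + t *\<^sub>R v) + f x) / t\<^sup>2 - L v\<bar> \<le> e"
      if t: "0 < t" "t < d" for t
    proof -
      have tr: "t * r < min d0 d1" using t rpos by (simp add: d_def field_simps)
      have nb: "norm (s *\<^sub>R u + q *\<^sub>R v) \<le> t * r" if "0 \<le> s" "s \<le> t" "0 \<le> q" "q \<le> t" for s q
      proof -
        have "norm (s *\<^sub>R u + q *\<^sub>R v) \<le> s * norm u + q * norm v"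
          using that norm_triangle_ineq[of "s *\<^sub>R u" "q *\<^sub>R v"] by simp
        also have "\<dots> \<le> t * norm u + t * norm v"
          using that by (intro add_mono mult_right_mono) auto
        also have "\<dots> \<le> t * r" using t by (simp add: r_def algebra_simps)
        finally show ?thesis .
      qed
      have inU: "x + s *\<^sub>R u + q *\<^sub>R v \<in> U" if "0 \<le> s" "s \<le> t" "0 \<le> q" "q \<le> t" for s q
      proof -
        have "dist (x + (s *\<^sub>R u + q *\<^sub>R v)) x < d0"
          using nb[OF that] tr by (simp add: dist_norm)
        then show ?thesis using d0 by (auto simp: subset_iff dist_commute add.assoc)
      qed
      have dline: "((\<lambda>s. f (x + s *\<^sub>R u + q *\<^sub>R v)) has_real_derivative fu (x + s *\<^sub>R u + q *\<^sub>R v)) (at s)"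
        if "0 \<le> s" "s \<le> t" "0 \<le> q" "q \<le> t" for s q
      proof -
        define y where "y = x + s *\<^sub>R u + q *\<^sub>R v"
        have "(f has_derivative frechet_derivative f (at y)) (at y)"
          using df[OF inU[OF that]] by (simp add: y_def frechet_derivative_works)
        then have "((\<lambda>s. f (x + s *\<^sub>R u + q *\<^sub>R v)) has_derivative
            (\<lambda>h. frechet_derivative f (at y) (h *\<^sub>R u))) (at s)"
          unfolding y_def
          by (rule has_derivative_compose[rotated]) (auto intro!: derivative_eq_intros)
        moreover have "frechet_derivative f (at y) (h *\<^sub>R u) = h * fu y" for h
          using linear_frechet_derivative[OF df[OF inU[OF that]]]
          by (simp add: y_def fu_def linear_scale)
        ultimately show ?thesis
          by (intro has_derivative_imp_has_field_derivative) (auto simp: y_def)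
      qed
      \<comment> \<open>The terms with coefficient 0 bring all four points into the form required by
        \<open>dline\<close>.\<close>
      have "\<exists>s. 0 < s \<and> s < t \<and>
          (f (x + t *\<^sub>R u + t *\<^sub>R v) - f (x + t *\<^sub>R u + 0 *\<^sub>R v))
           - (f (x + 0 *\<^sub>R u + t *\<^sub>R v) - f (x + 0 *\<^sub>R u + 0 *\<^sub>R v))
          = (t - 0) * (fu (x + s *\<^sub>R u + t *\<^sub>R v) - fu (x + s *\<^sub>R u + 0 *\<^sub>R v))"
        by (rule MVT2[OF t(1)]) (rule DERIV_diff; rule dline; use t in simp)
      then obtain s where s: "0 < s" "s < t" and
        eq: "f (x + t *\<^sub>R u + t *\<^sub>R v) - f (x + t *\<^sub>R u) - f (x + t *\<^sub>R v) + f x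
          = t * (fu (x + s *\<^sub>R u + t *\<^sub>R v) - fu (x + s *\<^sub>R u))"
        by (auto simp: algebra_simps)
      have b: "\<bar>fu (x + s *\<^sub>R u + q *\<^sub>R v) - fu x - L (s *\<^sub>R u + q *\<^sub>R v)\<bar> \<le> e' * (t * r)"
        if q: "0 \<le> q" "q \<le> t" for q
      proof -
        have "\<bar>fu (x + s *\<^sub>R u + q *\<^sub>R v) - fu x - L (s *\<^sub>R u + q *\<^sub>R v)\<bar>
            \<le> e' * norm (s *\<^sub>R u + q *\<^sub>R v)"
          using d1(2)[of "x + s *\<^sub>R u + q *\<^sub>R v"] nb[of s q] s q tr
          by (simp add: add.assoc)
        also have "\<dots> \<le> e' * (t * r)" using nb[of s q] s q e' by (intro mult_left_mono) auto
        finally show ?thesis .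
      qed
      have Lsplit: "L (s *\<^sub>R u + t *\<^sub>R v) = L (s *\<^sub>R u) + t * L v"
        using linL by (simp add: linear_add linear_scale)
      have "\<bar>fu (x + s *\<^sub>R u + t *\<^sub>R v) - fu (x + s *\<^sub>R u) - t * L v\<bar> \<le> 2 * (e' * (t * r))"
        using b[of t] b[of 0] t unfolding Lsplit by (simp add: abs_le_iff)
      also have "2 * (e' * (t * r)) = e * t" using rpos by (simp add: e'_def)
      finally have "\<bar>fu (x + s *\<^sub>R u + t *\<^sub>R v) - fu (x + s *\<^sub>R u) - t * L v\<bar> / t \<le> e"
        using t by (simp add: field_simps)
      moreover have "(t * (fu (x + s *\<^sub>R u + t *\<^sub>R v) - fu (x + s *\<^sub>R u))) / t\<^sup>2 - L v
          = (fu (x + s *\<^sub>R u + t *\<^sub>R v) - fu (x + s *\<^sub>R u) - t * L v) / t"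
        using t by (simp add: field_simps power2_eq_square)
      ultimately show ?thesis unfolding eq using t by (simp add: abs_divide)
    qed
    ultimately show ?thesis by blast
  qed
  show ?thesis
    unfolding fu_def[symmetric] L_def[symmetric]
  proof (rule tendstoI)
    fix e :: real assume "e > 0"
    then obtain d where "d > 0" and d: "\<And>t. 0 < t \<Longrightarrow> t < d \<Longrightarrow>
      \<bar>(f (x + t *\<^sub>R u + t *\<^sub>R v) - f (x + t *\<^sub>R u) - f (x + t *\<^sub>R v) + f x) / t\<^sup>2 - L v\<bar> \<le> e/2"
      using step[of "e/2"] by auto
    have "\<forall>\<^sub>F t in at_right 0. t < d \<and> 0 < (t::real)"
      using \<open>d > 0\<close> eventually_at_right_less[of 0] 
      by (auto simp: eventually_at_right intro!: exI[of _ d])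
    then show "\<forall>\<^sub>F t in at_right 0.
        dist ((f (x + t *\<^sub>R u + t *\<^sub>R v) - f (x + t *\<^sub>R u) - f (x + t *\<^sub>R v) + f x) / t\<^sup>2) (L v) < e"
    proof (rule eventually_mono)
      fix t assume "t < d \<and> 0 < t"
      then show "dist ((f (x + t *\<^sub>R u + t *\<^sub>R v) - f (x + t *\<^sub>R u) - f (x + t *\<^sub>R v) + f x) / t\<^sup>2) (L v) < e"
        using d[of t] \<open>e > 0\<close> by (simp add: dist_real_def)
    qed
  qed
qed

text \<open>The second difference quotient is symmetric in \<open>u\<close> and \<open>v\<close>, so
  both iterated derivatives are limits of the same function.\<close>

lemma second_derivative_symmetric_real:
  fixes f :: "'a::euclidean_space \<Rightarrow> real"
  assumes U: "open U" "x \<in> U"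
    and df: "\<And>y. y \<in> U \<Longrightarrow> f differentiable (at y)"
    and d2: "\<And>w. (\<lambda>y. frechet_derivative f (at y) w) differentiable (at x)"
  shows "frechet_derivative (\<lambda>y. frechet_derivative f (at y) u) (at x) v
       = frechet_derivative (\<lambda>y. frechet_derivative f (at y) v) (at x) u"
proof -
  have "x + t *\<^sub>R v + t *\<^sub>R u = x + t *\<^sub>R u + t *\<^sub>R v" for t by simp
  then have "((\<lambda>t. (f (x + t *\<^sub>R u + t *\<^sub>R v) - f (x + t *\<^sub>R u) - f (x + t *\<^sub>R v) + f x) / t\<^sup>2)
           \<longlongrightarrow> frechet_derivative (\<lambda>y. frechet_derivative f (at y) v) (at x) u) (at_right 0)"
    using second_difference_limit[OF U df d2, of v u] by (simp add: algebra_simps)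
  then show ?thesis
    using second_difference_limit[OF U df d2, of u v]
    by (rule tendsto_unique[OF trivial_limit_at_right_real, rotated])
qed

lemma has_derivative_cong_open:
  assumes "open U" "x \<in> U" "\<And>y. y \<in> U \<Longrightarrow> f y = g y"
  shows "(f has_derivative L) (at x) \<longleftrightarrow> (g has_derivative L) (at x)"
proof
  assume "(f has_derivative L) (at x)"
  then show "(g has_derivative L) (at x)"
    by (rule has_derivative_transform_within_open[OF _ assms(1,2)]) (simp add: assms(3))
next
  assume "(g has_derivative L) (at x)"
  then show "(f has_derivative L) (at x)"
    by (rule has_derivative_transform_within_open[OF _ assms(1,2)]) (simp add: assms(3))
qed

text \<open>\<open>frechet_derivative\<close> is a choice among all derivatives, so it agrees for
  two functions as soon as they have the same derivatives, even where neither has one.\<close>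

lemma frechet_derivative_cong_open:
  assumes "open U" "x \<in> U" "\<And>y. y \<in> U \<Longrightarrow> f y = g y"
  shows "frechet_derivative f (at x) = frechet_derivative g (at x)"
  unfolding frechet_derivative_def by (simp add: has_derivative_cong_open[OF assms])

lemma differentiable_cong_open:
  assumes "open U" "x \<in> U" "\<And>y. y \<in> U \<Longrightarrow> f y = g y"
  shows "f differentiable (at x) \<longleftrightarrow> g differentiable (at x)"
  unfolding differentiable_def by (simp add: has_derivative_cong_open[OF assms])

lemma frechet_derivative_linear_comp:
  assumes "f differentiable (at x)" "bounded_linear h"
  shows "frechet_derivative (\<lambda>y. h (f y)) (at x) u = h (frechet_derivative f (at x) u)"
proof -
  have "((\<lambda>y. h (f y)) has_derivative (\<lambda>u. h (frechet_derivative f (at x) u))) (at x)"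
    by (rule bounded_linear.has_derivative[OF assms(2) assms(1)[unfolded frechet_derivative_works]])
  from frechet_derivative_at[OF this, symmetric] show ?thesis by simp
qed

lemma differentiable_linear_comp:
  assumes "f differentiable (at x)" "bounded_linear h"
  shows "(\<lambda>y. h (f y)) differentiable (at x)"
  using bounded_linear.has_derivative[OF assms(2) assms(1)[unfolded frechet_derivative_works]]
  by (rule differentiableI)

text \<open>Reduction to the real case by taking inner products with the basis vectors.\<close>

lemma second_derivative_symmetric:
  fixes f :: "'a::euclidean_space \<Rightarrow> 'b::euclidean_space"
  assumes U: "open U" "x \<in> U"
    and df: "\<And>y. y \<in> U \<Longrightarrow> f differentiable (at y)"
    and d2: "\<And>w. (\<lambda>y. frechet_derivative f (at y) w) differentiable (at x)"
  shows "frechet_derivative (\<lambda>y. frechet_derivative f (at y) u) (at x) v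
       = frechet_derivative (\<lambda>y. frechet_derivative f (at y) v) (at x) u"
proof (rule euclidean_eqI)
  fix b :: 'b assume "b \<in> Basis"
  have bl: "bounded_linear (\<lambda>z. z \<bullet> b)" by (rule bounded_linear_inner_left)
  have 1: "frechet_derivative (\<lambda>z. f z \<bullet> b) (at y) w = frechet_derivative f (at y) w \<bullet> b"
    if "y \<in> U" for y w using frechet_derivative_linear_comp[OF df[OF that] bl] .
  have 2: "(\<lambda>y. frechet_derivative (\<lambda>z. f z \<bullet> b) (at y) w) differentiable (at x)" for w
    by (rule differentiable_cong_open[OF U 1, THEN iffD2]) (simp_all add: differentiable_linear_comp[OF d2[of w] bl])
  have 3: "frechet_derivative (\<lambda>y. frechet_derivative (\<lambda>z. f z \<bullet> b) (at y) w) (at x)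
      = frechet_derivative (\<lambda>y. frechet_derivative f (at y) w \<bullet> b) (at x)" for w
    by (rule frechet_derivative_cong_open[OF U 1])
  have "frechet_derivative (\<lambda>y. frechet_derivative f (at y) u \<bullet> b) (at x) v
    = frechet_derivative (\<lambda>y. frechet_derivative f (at y) v \<bullet> b) (at x) u"
    using second_derivative_symmetric_real[OF U differentiable_linear_comp[OF df bl] 2, of u v]
    unfolding 3 .
  then show "frechet_derivative (\<lambda>y. frechet_derivative f (at y) u) (at x) v \<bullet> b
    = frechet_derivative (\<lambda>y. frechet_derivative f (at y) v) (at x) u \<bullet> b"
    using frechet_derivative_linear_comp[OF d2 bl] by metis
qed

section \<open>Leibniz rules for fields of bilinear and linear maps\<close>

lemma bilinear_Basis_expansion:
  fixes B :: "'a::euclidean_space \<Rightarrow> 'b::euclidean_space \<Rightarrow> 'c::real_vector"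
  assumes "bilinear B"
  shows "B a b = (\<Sum>i\<in>Basis. \<Sum>j\<in>Basis. ((a \<bullet> i) * (b \<bullet> j)) *\<^sub>R B i j)"
proof -
  have "B a b = B (\<Sum>i\<in>Basis. (a \<bullet> i) *\<^sub>R i) (\<Sum>j\<in>Basis. (b \<bullet> j) *\<^sub>R j)"
    by (simp add: euclidean_representation)
  also have "\<dots> = (\<Sum>i\<in>Basis. \<Sum>j\<in>Basis. ((a \<bullet> i) * (b \<bullet> j)) *\<^sub>R B i j)"
    unfolding bilinear_sum[OF assms] sum.cartesian_product[symmetric]
    by (simp add: bilinear_lmul[OF assms] bilinear_rmul[OF assms] mult.commute)
  finally show ?thesis .
qed

text \<open>Differentiability of the field is assumed for constant arguments. Expanding both
  arguments in the basis gives a finite sum of products of differentiable functions.\<close>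

lemma has_derivative_bilinear_field:
  fixes B :: "'x::real_normed_vector \<Rightarrow> 'a::euclidean_space \<Rightarrow> 'b::euclidean_space \<Rightarrow> 'c::real_normed_vector"
  assumes U: "open U" "x \<in> U"
    and bil: "\<And>y. y \<in> U \<Longrightarrow> bilinear (B y)"
    and dB: "\<And>u v. (\<lambda>y. B y u v) differentiable (at x)"
    and da: "(a has_derivative a') (at x)" and db: "(b has_derivative b') (at x)"
  shows "((\<lambda>y. B y (a y) (b y)) has_derivative
     (\<lambda>h. frechet_derivative (\<lambda>y. B y (a x) (b x)) (at x) h + B x (a' h) (b x) + B x (a x) (b' h))) (at x)"
proof -
  let ?B' = "\<lambda>i j h. frechet_derivative (\<lambda>y. B y i j) (at x) h"
  have dBij: "((\<lambda>y. B y i j) has_derivative ?B' i j) (at x)" for i j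
    using dB by (simp add: frechet_derivative_works)
  have ai: "((\<lambda>y. a y \<bullet> i) has_derivative (\<lambda>h. a' h \<bullet> i)) (at x)" for i
    using da by (rule bounded_linear.has_derivative[OF bounded_linear_inner_left])
  have bi: "((\<lambda>y. b y \<bullet> i) has_derivative (\<lambda>h. b' h \<bullet> i)) (at x)" for i
    using db by (rule bounded_linear.has_derivative[OF bounded_linear_inner_left])
  have const: "((\<lambda>y. \<Sum>i\<in>Basis. \<Sum>j\<in>Basis. ((p \<bullet> i) * (q \<bullet> j)) *\<^sub>R B y i j) has_derivative
     (\<lambda>h. \<Sum>i\<in>Basis. \<Sum>j\<in>Basis. ((p \<bullet> i) * (q \<bullet> j)) *\<^sub>R ?B' i j h)) (at x)" for p q
    by (intro derivative_intros dBij)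
  have "((\<lambda>y. B y p q) has_derivative
     (\<lambda>h. \<Sum>i\<in>Basis. \<Sum>j\<in>Basis. ((p \<bullet> i) * (q \<bullet> j)) *\<^sub>R ?B' i j h)) (at x)" for p q
    by (rule has_derivative_transform_within_open[OF const U])
       (simp add: bilinear_Basis_expansion[OF bil, of _ p q])
  then have B'pq: "frechet_derivative (\<lambda>y. B y p q) (at x)
     = (\<lambda>h. \<Sum>i\<in>Basis. \<Sum>j\<in>Basis. ((p \<bullet> i) * (q \<bullet> j)) *\<^sub>R ?B' i j h)" for p q
    by (rule frechet_derivative_at[symmetric])
  have "((\<lambda>y. \<Sum>i\<in>Basis. \<Sum>j\<in>Basis. ((a y \<bullet> i) * (b y \<bullet> j)) *\<^sub>R B y i j) has_derivative
     (\<lambda>h. \<Sum>i\<in>Basis. \<Sum>j\<in>Basis. ((a x \<bullet> i) * (b x \<bullet> j)) *\<^sub>R ?B' i j h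
        + ((a x \<bullet> i) * (b' h \<bullet> j) + (a' h \<bullet> i) * (b x \<bullet> j)) *\<^sub>R B x i j)) (at x)"
    by (intro has_derivative_sum has_derivative_scaleR has_derivative_mult dBij ai bi)
  then have "((\<lambda>y. B y (a y) (b y)) has_derivative
     (\<lambda>h. \<Sum>i\<in>Basis. \<Sum>j\<in>Basis. ((a x \<bullet> i) * (b x \<bullet> j)) *\<^sub>R ?B' i j h
        + ((a x \<bullet> i) * (b' h \<bullet> j) + (a' h \<bullet> i) * (b x \<bullet> j)) *\<^sub>R B x i j)) (at x)"
    by (rule has_derivative_transform_within_open[OF _ U]) (rule bilinear_Basis_expansion[OF bil, symmetric])
  moreover have "(\<Sum>i\<in>Basis. \<Sum>j\<in>Basis. ((a x \<bullet> i) * (b x \<bullet> j)) *\<^sub>R ?B' i j h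
        + ((a x \<bullet> i) * (b' h \<bullet> j) + (a' h \<bullet> i) * (b x \<bullet> j)) *\<^sub>R B x i j)
     = frechet_derivative (\<lambda>y. B y (a x) (b x)) (at x) h + B x (a' h) (b x) + B x (a x) (b' h)" for h
    unfolding B'pq[of "a x" "b x"] bilinear_Basis_expansion[OF bil[OF U(2)], of "a' h"]
      bilinear_Basis_expansion[OF bil[OF U(2)], of "a x"]
    by (simp add: sum.distrib scaleR_add_left)
  ultimately show ?thesis by simp
qed

lemma has_derivative_linear_field:
  fixes L :: "'x::real_normed_vector \<Rightarrow> 'a::euclidean_space \<Rightarrow> 'c::real_normed_vector"
  assumes U: "open U" "x \<in> U"
    and lin: "\<And>y. y \<in> U \<Longrightarrow> linear (L y)"
    and dL: "\<And>u. (\<lambda>y. L y u) differentiable (at x)"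
    and da: "(a has_derivative a') (at x)"
  shows "((\<lambda>y. L y (a y)) has_derivative
     (\<lambda>h. frechet_derivative (\<lambda>y. L y (a x)) (at x) h + L x (a' h))) (at x)"
proof -
  \<comment> \<open>A linear map becomes bilinear through an extra scalar argument, which is then
    held at 1.\<close>
  have bil: "bilinear (\<lambda>u (r::real). r *\<^sub>R L y u)" if "y \<in> U" for y
    using lin[OF that] by (auto simp: bilinear_def linear_iff algebra_simps)
  have "((\<lambda>y. 1 *\<^sub>R L y (a y)) has_derivative
     (\<lambda>h. frechet_derivative (\<lambda>y. 1 *\<^sub>R L y (a x)) (at x) h + 1 *\<^sub>R L x (a' h) + 0 *\<^sub>R L x (a x))) (at x)"
    by (rule has_derivative_bilinear_field[OF U bil _ da has_derivative_const])
       (auto intro!: derivative_intros dL)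
  then show ?thesis by simp
qed

section \<open>Clifford multiplication\<close>

text \<open>The module is a real Euclidean space, as the derivative lemmas require; complex scalars
  enter later as the real-linear map \<open>K\<close> of \<open>killing_patch\<close>.\<close>

locale clifford_module =
  fixes P :: "'n::finite \<Rightarrow> 'v::euclidean_space \<Rightarrow> 'v"
  assumes linear_P: "linear (P i)"
    and anticommute: "P i (P j w) + P j (P i w) = (if i = j then -2 *\<^sub>R w else 0)"
begin

text \<open>The sum runs over all ordered pairs, so for skew \<open>W\<close> it is twice the
  Clifford action of the 2-form with these components, and the spin representation is a quarter of
  \<open>cquad\<close>.\<close>

definition cquad :: "('n \<Rightarrow> 'n \<Rightarrow> real) \<Rightarrow> 'v \<Rightarrow> 'v" where
  "cquad W w = (\<Sum>i\<in>UNIV. \<Sum>j\<in>UNIV. W i j *\<^sub>R P i (P j w))"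

definition cvec :: "('n \<Rightarrow> real) \<Rightarrow> 'v \<Rightarrow> 'v" where
  "cvec a w = (\<Sum>i\<in>UNIV. a i *\<^sub>R P i w)"

lemma P_add: "P i (v + w) = P i v + P i w"
  and P_diff: "P i (v - w) = P i v - P i w"
  and P_minus: "P i (- v) = - P i v"
  and P_scaleR: "P i (r *\<^sub>R v) = r *\<^sub>R P i v"
  and P_sum: "P i (sum h A) = (\<Sum>a\<in>A. P i (h a))"
  and P_zero: "P i 0 = 0"
  using linear_P[of i]
  by (auto simp: linear_add linear_diff linear_neg linear_scale linear_sum linear_0)

lemma linear_cquad: "linear (cquad W)"
  by (rule linearI) (simp_all add: cquad_def P_add P_scaleR scaleR_add_right sum.distrib scaleR_sum_right mult.commute)

lemma linear_cvec: "linear (cvec a)"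
  by (rule linearI) (simp_all add: cvec_def P_add P_scaleR scaleR_add_right sum.distrib scaleR_sum_right mult.commute)

lemma cquad_add: "cquad (\<lambda>i j. V i j + W i j) w = cquad V w + cquad W w"
  and cquad_diff: "cquad (\<lambda>i j. V i j - W i j) w = cquad V w - cquad W w"
  by (simp_all add: cquad_def scaleR_add_left scaleR_diff_left sum.distrib sum_subtractf scaleR_sum_right)

lemma cvec_add: "cvec (\<lambda>i. a i + b i) w = cvec a w + cvec b w"
  and cvec_diff: "cvec (\<lambda>i. a i - b i) w = cvec a w - cvec b w"
  and cvec_scale: "cvec (\<lambda>i. r * a i) w = r *\<^sub>R cvec a w"
  by (simp_all add: cvec_def scaleR_add_left scaleR_diff_left sum.distrib sum_subtractf scaleR_sum_right)

lemma cvec_anticommute: "cvec a (cvec b w) + cvec b (cvec a w) = (-2 * (\<Sum>i\<in>UNIV. a i * b i)) *\<^sub>R w"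
proof -
  have "cvec a (cvec b w) = (\<Sum>i\<in>UNIV. \<Sum>j\<in>UNIV. (a i * b j) *\<^sub>R P i (P j w))"
    by (simp add: cvec_def P_sum P_scaleR scaleR_sum_right)
  moreover have "cvec b (cvec a w) = (\<Sum>i\<in>UNIV. \<Sum>j\<in>UNIV. (a i * b j) *\<^sub>R P j (P i w))"
    by (subst sum.swap) (simp add: cvec_def P_sum P_scaleR scaleR_sum_right mult.commute)
  ultimately have "cvec a (cvec b w) + cvec b (cvec a w)
      = (\<Sum>i\<in>UNIV. \<Sum>j\<in>UNIV. (a i * b j) *\<^sub>R (P i (P j w) + P j (P i w)))"
    by (simp add: sum.distrib[symmetric] scaleR_add_right)
  also have "\<dots> = (\<Sum>i\<in>UNIV. \<Sum>j\<in>UNIV. if i = j then (-2 * (a i * b j)) *\<^sub>R w else 0)"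
    by (intro sum.cong refl) (simp add: anticommute)
  also have "\<dots> = (-2 * (\<Sum>i\<in>UNIV. a i * b i)) *\<^sub>R w"
    by (simp add: scaleR_sum_left sum_distrib_left)
  finally show ?thesis .
qed

text \<open>For skew \<open>N\<close>, the commutator with a quarter of \<open>cquad N\<close> acts
  on vectors as the matrix \<open>N\<close>. Moving \<open>P k\<close> through
  \<open>P i (P j w)\<close> leaves one contraction with each factor, and skewness makes the two
  contributions equal.\<close>

lemma cquad_P_commutator:
  assumes N: "\<And>i j. N j i = - N i j"
  shows "cquad N (P k w) - P k (cquad N w) = 4 *\<^sub>R (\<Sum>j\<in>UNIV. N k j *\<^sub>R P j w)"
proof -
  have swap: "P i (P j v) = (if i = j then -2 *\<^sub>R v else 0) - P j (P i v)" for i j v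
    by (simp only: eq_diff_eq anticommute)
  have ij: "P i (P j (P k w)) - P k (P i (P j w))
      = (if i = k then 2 *\<^sub>R P j w else 0) - (if j = k then 2 *\<^sub>R P i w else 0)" for i j
  proof -
    have "P i (P j (P k w)) = P i ((if j = k then -2 *\<^sub>R w else 0) - P k (P j w))"
      by (simp only: swap[of j k])
    also have "\<dots> = (if j = k then -2 *\<^sub>R P i w else 0) - P i (P k (P j w))"
      by (simp add: P_diff P_scaleR P_zero P_minus)
    also have "P i (P k (P j w)) = (if i = k then -2 *\<^sub>R P j w else 0) - P k (P i (P j w))"
      by (rule swap)
    finally show ?thesis by simp
  qed
  have "cquad N (P k w) - P k (cquad N w)
      = (\<Sum>i\<in>UNIV. \<Sum>j\<in>UNIV. N i j *\<^sub>R (P i (P j (P k w)) - P k (P i (P j w))))"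
    by (simp add: cquad_def P_sum P_scaleR sum_subtractf scaleR_diff_right)
  also have "\<dots> = (\<Sum>i\<in>UNIV. \<Sum>j\<in>UNIV. if i = k then N i j *\<^sub>R 2 *\<^sub>R P j w else 0)
      - (\<Sum>i\<in>UNIV. \<Sum>j\<in>UNIV. if j = k then N i j *\<^sub>R 2 *\<^sub>R P i w else 0)"
    unfolding ij sum_subtractf[symmetric] by (intro sum.cong refl) (simp add: scaleR_diff_right)
  also have "(\<Sum>i\<in>UNIV. \<Sum>j\<in>UNIV. if i = k then N i j *\<^sub>R 2 *\<^sub>R P j w else 0)
      = (\<Sum>j\<in>UNIV. N k j *\<^sub>R 2 *\<^sub>R P j w)"
    by (subst sum.swap) simp
  also have "(\<Sum>i\<in>UNIV. \<Sum>j\<in>UNIV. if j = k then N i j *\<^sub>R 2 *\<^sub>R P i w else 0)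
      = - (\<Sum>j\<in>UNIV. N k j *\<^sub>R 2 *\<^sub>R P j w)"
    by (simp add: N[of k] sum_negf del: scaleR_scaleR)
  finally show ?thesis by (simp add: scaleR_sum_right mult.commute flip: sum.distrib scaleR_add_left)
qed

lemma cquad_cvec_commutator:
  assumes N: "\<And>i j. N j i = - N i j"
  shows "cquad N (cvec a w) - cvec a (cquad N w) = 4 *\<^sub>R cvec (\<lambda>j. \<Sum>k\<in>UNIV. a k * N k j) w"
proof -
  have "cquad N (cvec a w) - cvec a (cquad N w) = (\<Sum>k\<in>UNIV. a k *\<^sub>R (cquad N (P k w) - P k (cquad N w)))"
    unfolding cvec_def
    by (simp add: linear_sum[OF linear_cquad] linear_scale[OF linear_cquad] sum_subtractf scaleR_diff_right)
  also have "\<dots> = 4 *\<^sub>R (\<Sum>k\<in>UNIV. \<Sum>j\<in>UNIV. (a k * N k j) *\<^sub>R P j w)"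
    unfolding cquad_P_commutator[OF N] by (simp add: scaleR_sum_right mult.left_commute mult.commute)
  also have "\<dots> = 4 *\<^sub>R cvec (\<lambda>j. \<Sum>k\<in>UNIV. a k * N k j) w"
    by (subst sum.swap) (simp add: cvec_def scaleR_sum_left)
  finally show ?thesis .
qed

text \<open>The commutator with \<open>cquad N\<close> is a derivation, so
  \<open>cquad_P_commutator\<close> applies to each factor of \<open>P k (P l w)\<close>. Up to the
  order of the factors, a quarter of \<open>cquad\<close> thus respects commutators.\<close>

lemma cquad_cquad_commutator:
  assumes N: "\<And>i j. N j i = - N i j"
  shows "cquad N (cquad M w) - cquad M (cquad N w)
    = 4 *\<^sub>R cquad (\<lambda>i j. \<Sum>k\<in>UNIV. M i k * N k j - N i k * M k j) w"
proof -
  have NM: "M k l * N k j = - (N j k * M k l)" for j k l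
    using N[of j k] by simp
  have kl: "cquad N (P k (P l w)) - P k (P l (cquad N w))
      = 4 *\<^sub>R ((\<Sum>j\<in>UNIV. N k j *\<^sub>R P j (P l w)) + (\<Sum>j\<in>UNIV. N l j *\<^sub>R P k (P j w)))" for k l
  proof -
    have "cquad N (P k (P l w)) - P k (P l (cquad N w))
      = (cquad N (P k (P l w)) - P k (cquad N (P l w))) + P k (cquad N (P l w) - P l (cquad N w))"
      by (simp add: P_diff)
    then show ?thesis unfolding cquad_P_commutator[OF N]
      by (simp add: P_scaleR P_sum scaleR_add_right)
  qed
  have "cquad N (cquad M w) - cquad M (cquad N w)
      = (\<Sum>k\<in>UNIV. \<Sum>l\<in>UNIV. M k l *\<^sub>R (cquad N (P k (P l w)) - P k (P l (cquad N w))))"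
    unfolding cquad_def[of M]
    by (simp add: linear_sum[OF linear_cquad] linear_scale[OF linear_cquad] sum_subtractf scaleR_diff_right)
  also have "\<dots> = 4 *\<^sub>R ((\<Sum>k\<in>UNIV. \<Sum>l\<in>UNIV. \<Sum>j\<in>UNIV. (M k l * N k j) *\<^sub>R P j (P l w))
      + (\<Sum>k\<in>UNIV. \<Sum>l\<in>UNIV. \<Sum>j\<in>UNIV. (M k l * N l j) *\<^sub>R P k (P j w)))"
    unfolding kl by (simp add: scaleR_sum_right scaleR_add_right sum.distrib mult.left_commute)
  also have "(\<Sum>k\<in>UNIV. \<Sum>l\<in>UNIV. \<Sum>j\<in>UNIV. (M k l * N k j) *\<^sub>R P j (P l w))
      = (\<Sum>j\<in>UNIV. \<Sum>l\<in>UNIV. \<Sum>k\<in>UNIV. (M k l * N k j) *\<^sub>R P j (P l w))"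
    by (subst sum.swap, subst (2) sum.swap, subst sum.swap) simp
  also have "\<dots> = cquad (\<lambda>i j. \<Sum>k\<in>UNIV. - (N i k * M k j)) w"
    unfolding cquad_def scaleR_sum_left
    by (intro sum.cong refl) (simp only: NM)
  also have "(\<Sum>k\<in>UNIV. \<Sum>l\<in>UNIV. \<Sum>j\<in>UNIV. (M k l * N l j) *\<^sub>R P k (P j w))
      = cquad (\<lambda>i j. \<Sum>k\<in>UNIV. M i k * N k j) w"
    unfolding cquad_def scaleR_sum_left by (subst (2) sum.swap) simp
  finally show ?thesis
    by (simp add: cquad_add[symmetric] sum.distrib[symmetric])
qed

section \<open>Leibniz rules for Clifford products\<close>

lemma has_derivative_P:
  assumes "(\<psi> has_derivative \<psi>') F"
  shows "((\<lambda>y. P i (\<psi> y)) has_derivative (\<lambda>h. P i (\<psi>' h))) F"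
  by (rule bounded_linear.has_derivative[OF linear_P[unfolded linear_conv_bounded_linear] assms])

lemma has_derivative_cvec:
  assumes "\<And>i. ((\<lambda>y. a y i) has_derivative (\<lambda>h. a' h i)) (at x)"
    and "(\<psi> has_derivative \<psi>') (at x)"
  shows "((\<lambda>y. cvec (a y) (\<psi> y)) has_derivative (\<lambda>h. cvec (a' h) (\<psi> x) + cvec (a x) (\<psi>' h))) (at x)"
proof -
  have "((\<lambda>y. cvec (a y) (\<psi> y)) has_derivative
      (\<lambda>h. \<Sum>i\<in>UNIV. a x i *\<^sub>R P i (\<psi>' h) + a' h i *\<^sub>R P i (\<psi> x))) (at x)"
    unfolding cvec_def
    by (intro has_derivative_sum has_derivative_scaleR has_derivative_P assms)
  then show ?thesis by (simp add: cvec_def sum.distrib add.commute)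
qed

lemma has_derivative_cquad:
  assumes "\<And>i j. ((\<lambda>y. W y i j) has_derivative (\<lambda>h. W' h i j)) (at x)"
    and "(\<psi> has_derivative \<psi>') (at x)"
  shows "((\<lambda>y. cquad (W y) (\<psi> y)) has_derivative (\<lambda>h. cquad (W' h) (\<psi> x) + cquad (W x) (\<psi>' h))) (at x)"
proof -
  have "((\<lambda>y. cquad (W y) (\<psi> y)) has_derivative
      (\<lambda>h. \<Sum>i\<in>UNIV. \<Sum>j\<in>UNIV. W x i j *\<^sub>R P i (P j (\<psi>' h)) + W' h i j *\<^sub>R P i (P j (\<psi> x)))) (at x)"
    unfolding cquad_def
    by (intro has_derivative_sum has_derivative_scaleR has_derivative_P assms)
  then show ?thesis by (simp add: cquad_def sum.distrib add.commute)
qed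

end

section \<open>Metric connections in a chart\<close>

text \<open>Linearity is in the parameter \<open>u\<close>, with the direction \<open>h\<close>
  fixed; it makes the differentiated Christoffel terms of the curvature linear in their vector
  slots.\<close>

lemma linear_frechet_derivative_family:
  assumes U: "open U" "x \<in> U" and lin: "\<And>y. y \<in> U \<Longrightarrow> linear (L y)"
    and dL: "\<And>u. (\<lambda>y. L y u) differentiable (at x)"
  shows "linear (\<lambda>u. frechet_derivative (\<lambda>y. L y u) (at x) h)"
proof (rule linearI)
  note works = dL[unfolded frechet_derivative_works]
  fix a b and r :: real
  have "((\<lambda>y. L y (a + b)) has_derivative
    (\<lambda>h. frechet_derivative (\<lambda>y. L y a) (at x) h + frechet_derivative (\<lambda>y. L y b) (at x) h)) (at x)"
    by (rule has_derivative_cong_open[OF U, THEN iffD2, OF _ has_derivative_add[OF works works]])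
       (rule linear_add[OF lin])
  from frechet_derivative_at[OF this, symmetric]
  show "frechet_derivative (\<lambda>y. L y (a + b)) (at x) h
    = frechet_derivative (\<lambda>y. L y a) (at x) h + frechet_derivative (\<lambda>y. L y b) (at x) h" by simp
  have "((\<lambda>y. L y (r *\<^sub>R a)) has_derivative (\<lambda>h. r *\<^sub>R frechet_derivative (\<lambda>y. L y a) (at x) h)) (at x)"
    by (rule has_derivative_cong_open[OF U, THEN iffD2, OF _ has_derivative_scaleR_right[OF works]])
       (rule linear_scale[OF lin])
  from frechet_derivative_at[OF this, symmetric]
  show "frechet_derivative (\<lambda>y. L y (r *\<^sub>R a)) (at x) h
    = r *\<^sub>R frechet_derivative (\<lambda>y. L y a) (at x) h" by simp
qed

text \<open>\<open>Q\<close> pairs coordinate vectors with the frame and \<open>M\<close> has the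
  frame vectors as columns. Orthonormality says \<open>Q ** M = mat 1\<close>; both are square, so
  \<open>M ** Q = mat 1\<close>, and this applied to \<open>z\<close> is the expansion.\<close>

lemma orthonormal_expansion:
  fixes B :: "real^'n::finite \<Rightarrow> real^'n \<Rightarrow> real" and e :: "'n \<Rightarrow> real^'n"
  assumes bil: "bilinear B" and orth: "\<And>i j. B (e i) (e j) = (if i = j then 1 else 0)"
  shows "z = (\<Sum>j\<in>UNIV. B z (e j) *\<^sub>R e j)"
proof -
  have lin: "linear (\<lambda>z. B z w)" for w using bil by (simp add: bilinear_def)
  have exp: "B z w = (\<Sum>i\<in>UNIV. z $ i * B (axis i 1) w)" for z w
  proof -
    have "B z w = B (\<Sum>i\<in>UNIV. z $ i *s axis i 1) w" by (simp add: basis_expansion)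
    then show ?thesis
      by (simp add: linear_sum[OF lin] linear_scale[OF lin] scalar_mult_eq_scaleR)
  qed
  define M where "M = (\<chi> i j. e j $ i)"
  define Q where "Q = (\<chi> j i. B (axis i 1) (e j))"
  have "Q ** M = mat 1"
    unfolding vec_eq_iff matrix_matrix_mult_def mat_def M_def Q_def
    using orth exp[of "e _" "e _"] by (simp add: mult.commute)
  then have "M ** Q = mat 1" by (simp add: matrix_left_right_inverse)
  then have "z = M *v (Q *v z)" by (simp add: matrix_vector_mul_assoc)
  also have "Q *v z = (\<chi> j. B z (e j))"
    unfolding vec_eq_iff matrix_vector_mult_def Q_def by (simp add: exp[of z] mult.commute)
  also have "M *v (\<chi> j. B z (e j)) = (\<Sum>j\<in>UNIV. B z (e j) *\<^sub>R e j)"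
    by (simp add: vec_eq_iff matrix_vector_mult_def M_def mult.commute)
  finally show ?thesis .
qed

text \<open>Allows \<open>ricci\<close>, a trace in coordinates, to be computed in an orthonormal
  frame.\<close>

lemma trace_orthonormal:
  fixes B :: "real^'n::finite \<Rightarrow> real^'n \<Rightarrow> real" and e :: "'n \<Rightarrow> real^'n"
  assumes bil: "bilinear B" and orth: "\<And>i j. B (e i) (e j) = (if i = j then 1 else 0)"
    and L: "linear L"
  shows "(\<Sum>i\<in>UNIV. L (axis i 1) $ i) = (\<Sum>j\<in>UNIV. B (L (e j)) (e j))"
proof -
  have linB: "linear (\<lambda>z. B z w)" for w using bil by (simp add: bilinear_def)
  have "(\<Sum>i\<in>UNIV. L (axis i 1) $ i)
      = (\<Sum>i\<in>UNIV. \<Sum>j\<in>UNIV. B (axis i 1) (e j) * L (e j) $ i)"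
    by (subst orthonormal_expansion[OF bil orth, of "axis _ 1"])
       (simp add: linear_sum[OF L] linear_scale[OF L])
  also have "\<dots> = (\<Sum>j\<in>UNIV. \<Sum>i\<in>UNIV. L (e j) $ i * B (axis i 1) (e j))"
    by (subst sum.swap) (simp add: mult.commute)
  also have "\<dots> = (\<Sum>j\<in>UNIV. B (\<Sum>i\<in>UNIV. L (e j) $ i *s axis i 1) (e j))"
    by (simp add: linear_sum[OF linB] linear_scale[OF linB] scalar_mult_eq_scaleR)
  finally show ?thesis by (simp add: basis_expansion)
qed

text \<open>The expression of \<open>curvature\<close> for the Christoffel map of a single chart,
  free of the atlas.\<close>

definition curv ::
  "(real^'n \<Rightarrow> real^'n \<Rightarrow> real^'n \<Rightarrow> real^'n::finite) \<Rightarrow> real^'n \<Rightarrow> real^'n \<Rightarrow> real^'n \<Rightarrow> real^'n \<Rightarrow> real^'n" where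
  "curv C x u v w = nabla_vec C (\<lambda>y. C y v w) x u - nabla_vec C (\<lambda>y. C y u w) x v"

section \<open>Connections and metrics on an open coordinate domain\<close>

locale connection_patch =
  fixes U :: "(real^'n::finite) set"
    and C :: "real^'n \<Rightarrow> real^'n \<Rightarrow> real^'n \<Rightarrow> real^'n"
  assumes open_U: "open U"
    and bil_C: "x \<in> U \<Longrightarrow> bilinear (C x)"
    and diff_C: "x \<in> U \<Longrightarrow> (\<lambda>y. C y u v) differentiable (at x)"
begin

lemma has_derivative_C:
  assumes x: "x \<in> U" and a: "(a has_derivative a') (at x)" and b: "(b has_derivative b') (at x)"
  shows "((\<lambda>y. C y (a y) (b y)) has_derivative
     (\<lambda>h. frechet_derivative (\<lambda>y. C y (a x) (b x)) (at x) h + C x (a' h) (b x) + C x (a x) (b' h))) (at x)"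
  by (rule has_derivative_bilinear_field[OF open_U x bil_C diff_C[OF x] a b])

lemma nabla_vec_has_derivative:
  assumes x: "x \<in> U" and X: "\<And>y. y \<in> U \<Longrightarrow> X differentiable (at y)"
    and dX: "(\<lambda>y. frechet_derivative X (at y) v) differentiable (at x)"
  shows "((\<lambda>y. nabla_vec C X y v) has_derivative
    (\<lambda>u. frechet_derivative (\<lambda>y. frechet_derivative X (at y) v) (at x) u
      + (frechet_derivative (\<lambda>y. C y v (X x)) (at x) u + C x v (frechet_derivative X (at x) u)))) (at x)"
proof -
  have "C x 0 w = 0" for w using bil_C[OF x] by (rule bilinear_lzero)
  then have "((\<lambda>y. C y v (X y)) has_derivative
     (\<lambda>h. frechet_derivative (\<lambda>y. C y v (X x)) (at x) h + C x v (frechet_derivative X (at x) h))) (at x)"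
    using has_derivative_C[OF x has_derivative_const[of v] X[OF x, unfolded frechet_derivative_works]]
    by simp
  then show ?thesis unfolding nabla_vec_def
    by (intro has_derivative_add dX[unfolded frechet_derivative_works])
qed

text \<open>\<open>curv\<close> is defined through constant fields; here it becomes the commutator
  of covariant derivatives on a general field \<open>X\<close>. Second derivatives of
  \<open>X\<close> cancel by symmetry, and the mixed first-order terms are symmetric in
  \<open>u\<close> and \<open>v\<close>.\<close>

lemma ricci_identity:
  assumes x: "x \<in> U" and X: "\<And>y. y \<in> U \<Longrightarrow> X differentiable (at y)"
    and dX: "\<And>v. (\<lambda>y. frechet_derivative X (at y) v) differentiable (at x)"
  shows "nabla_vec C (\<lambda>y. nabla_vec C X y v) x u - nabla_vec C (\<lambda>y. nabla_vec C X y u) x v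
    = curv C x u v (X x)"
proof -
  have fd: "frechet_derivative (\<lambda>y. nabla_vec C X y v) (at x) u =
     frechet_derivative (\<lambda>y. frechet_derivative X (at y) v) (at x) u
      + (frechet_derivative (\<lambda>y. C y v (X x)) (at x) u + C x v (frechet_derivative X (at x) u))" for u v
    by (rule fun_cong[OF frechet_derivative_at[OF nabla_vec_has_derivative[OF x X dX]], symmetric])
  have sym: "frechet_derivative (\<lambda>y. frechet_derivative X (at y) v) (at x) u
      = frechet_derivative (\<lambda>y. frechet_derivative X (at y) u) (at x) v" for u v
    by (rule second_derivative_symmetric[OF open_U x X dX])
  have nn: "nabla_vec C (\<lambda>y. nabla_vec C X y v) x u =
     frechet_derivative (\<lambda>y. frechet_derivative X (at y) v) (at x) u
      + (frechet_derivative (\<lambda>y. C y v (X x)) (at x) u + C x v (frechet_derivative X (at x) u))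
      + (C x u (frechet_derivative X (at x) v) + C x u (C x v (X x)))" for u v
    unfolding nabla_vec_def[of C "\<lambda>y. nabla_vec C X y v"] fd
    by (simp add: nabla_vec_def bilinear_radd[OF bil_C[OF x]])
  show ?thesis
    unfolding nn unfolding curv_def nabla_vec_def sym[of v u] by simp
qed

lemma curv_antisym: "curv C x v u w = - curv C x u v w"
  by (simp add: curv_def)

lemma linear_C:
  assumes x: "x \<in> U"
  shows "linear (\<lambda>u. C x u v)" "linear (C x u)"
  using bil_C[OF x] by (simp_all add: bilinear_def)

lemma linear_curv:
  assumes x: "x \<in> U"
  shows "linear (\<lambda>u. curv C x u v w)" "linear (\<lambda>v. curv C x u v w)" "linear (\<lambda>w. curv C x u v w)"
proof -
  have l1: "linear (\<lambda>v. frechet_derivative (\<lambda>y. C y v w) (at x) h)" for w h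
    by (rule linear_frechet_derivative_family[OF open_U x linear_C(1) diff_C[OF x]])
  have l2: "linear (\<lambda>w. frechet_derivative (\<lambda>y. C y v w) (at x) h)" for v h
    by (rule linear_frechet_derivative_family[OF open_U x linear_C(2) diff_C[OF x]])
  have l3: "linear (\<lambda>h. frechet_derivative (\<lambda>y. C y v w) (at x) h)" for v w
    using linear_frechet_derivative[OF diff_C[OF x]] .
  note comp = linear_compose[OF linear_C(1)[OF x] linear_C(2)[OF x], unfolded o_def]
    linear_compose[OF linear_C(2)[OF x] linear_C(2)[OF x], unfolded o_def] linear_C[OF x]
  show "linear (\<lambda>u. curv C x u v w)" "linear (\<lambda>v. curv C x u v w)" "linear (\<lambda>w. curv C x u v w)"
    unfolding curv_def nabla_vec_def
    by (intro linear_compose_sub linear_compose_add l1 l2 l3 comp)+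
qed

end

locale metric_patch = connection_patch U C
  for U :: "(real^'n::finite) set" and C +
  fixes G :: "real^'n \<Rightarrow> real^'n \<Rightarrow> real^'n \<Rightarrow> real"
  assumes bil_G: "x \<in> U \<Longrightarrow> bilinear (G x)"
    and sym_G: "x \<in> U \<Longrightarrow> G x u v = G x v u"
    and pos_G: "x \<in> U \<Longrightarrow> u \<noteq> 0 \<Longrightarrow> G x u u > 0"
    and diff_G: "x \<in> U \<Longrightarrow> (\<lambda>y. G y u v) differentiable (at x)"
    and metric_C: "x \<in> U \<Longrightarrow> frechet_derivative (\<lambda>y. G y v w) (at x) u = G x (C x u v) w + G x v (C x u w)"
begin

lemma has_derivative_G:
  assumes x: "x \<in> U" and a: "(a has_derivative a') (at x)" and b: "(b has_derivative b') (at x)"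
  shows "((\<lambda>y. G y (a y) (b y)) has_derivative
     (\<lambda>h. G x (a' h + C x h (a x)) (b x) + G x (a x) (b' h + C x h (b x)))) (at x)"
  using has_derivative_bilinear_field[OF open_U x bil_G diff_G[OF x] a b]
  by (simp add: metric_C[OF x] bilinear_ladd[OF bil_G[OF x]] bilinear_radd[OF bil_G[OF x]] algebra_simps)

lemma has_derivative_G_nabla:
  assumes x: "x \<in> U" and X: "X differentiable (at x)" and Y: "Y differentiable (at x)"
  shows "((\<lambda>y. G y (X y) (Y y)) has_derivative
     (\<lambda>u. G x (nabla_vec C X x u) (Y x) + G x (X x) (nabla_vec C Y x u))) (at x)"
  using has_derivative_G[OF x X[unfolded frechet_derivative_works] Y[unfolded frechet_derivative_works]]
  by (simp add: nabla_vec_def)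

lemma nabla_vec_const: "nabla_vec C (\<lambda>_. v) x u = C x u v"
  by (simp add: nabla_vec_def)

text \<open>The second derivatives of \<open>G y w z\<close>, computed from \<open>metric_C\<close>,
  contain besides the terms that make up \<open>curv\<close> only cross terms symmetric in
  \<open>u\<close> and \<open>v\<close>; antisymmetrising leaves the curvature.\<close>

lemma curv_skew:
  assumes x: "x \<in> U"
  shows "G x (curv C x u v w) z = - G x w (curv C x u v z)"
proof -
  have d1: "frechet_derivative (\<lambda>y. G y w z) (at y) v = G y (C y v w) z + G y w (C y v z)"
    if "y \<in> U" for y v using metric_C[OF that] .
  have diffconst: "(\<lambda>_. c) differentiable (at x)" for c :: "real^'n" by simp
  have h: "((\<lambda>y. G y (C y v w) z + G y w (C y v z)) has_derivative
     (\<lambda>u. (G x (nabla_vec C (\<lambda>y. C y v w) x u) z + G x (C x v w) (C x u z))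
        + (G x (C x u w) (C x v z) + G x w (nabla_vec C (\<lambda>y. C y v z) x u)))) (at x)" for v
    using has_derivative_G_nabla[OF x diff_C[OF x, of v w] diffconst[of z]]
      has_derivative_G_nabla[OF x diffconst[of w] diff_C[OF x, of v z]]
    by (intro has_derivative_add) (simp_all add: nabla_vec_const)
  have h': "((\<lambda>y. frechet_derivative (\<lambda>y. G y w z) (at y) v) has_derivative
     (\<lambda>u. (G x (nabla_vec C (\<lambda>y. C y v w) x u) z + G x (C x v w) (C x u z))
        + (G x (C x u w) (C x v z) + G x w (nabla_vec C (\<lambda>y. C y v z) x u)))) (at x)" for v
    by (rule has_derivative_cong_open[OF open_U x d1, THEN iffD2, OF _ h])
  have "frechet_derivative (\<lambda>y. frechet_derivative (\<lambda>y. G y w z) (at y) v) (at x) u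
      = frechet_derivative (\<lambda>y. frechet_derivative (\<lambda>y. G y w z) (at y) u) (at x) v"
    by (rule second_derivative_symmetric[OF open_U x diff_G differentiableI[OF h']])
  then show ?thesis
    unfolding frechet_derivative_at[OF h', symmetric]
    by (simp add: curv_def bilinear_lsub[OF bil_G[OF x]] bilinear_rsub[OF bil_G[OF x]])
qed

end

text \<open>\<open>killing\<close> is the Killing equation for the spin connection induced by
  \<open>C\<close>, solved for the ordinary derivative. \<open>K\<close> abstracts multiplication by
  the complex Killing number; what is kept is real linearity and commutation with Clifford
  multiplication.\<close>

locale killing_patch = metric_patch U C G + clifford_module P
  for U :: "(real^'n::finite) set" and C G and P :: "'n \<Rightarrow> 'v::euclidean_space \<Rightarrow> 'v" +
  fixes E :: "real^'n \<Rightarrow> 'n \<Rightarrow> real^'n" and K :: "'v \<Rightarrow> 'v" and \<psi> :: "real^'n \<Rightarrow> 'v"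
  assumes orth_E: "x \<in> U \<Longrightarrow> G x (E x i) (E x j) = (if i = j then 1 else 0)"
    and diff_E: "x \<in> U \<Longrightarrow> (\<lambda>y. E y i) differentiable (at x)"
    and diff2_E: "x \<in> U \<Longrightarrow> (\<lambda>y. frechet_derivative (\<lambda>z. E z i) (at y) v) differentiable (at x)"
    and linear_K: "linear K"
    and K_P: "K (P i w) = P i (K w)"
    and diff_\<psi>: "x \<in> U \<Longrightarrow> \<psi> differentiable (at x)"
    and killing: "x \<in> U \<Longrightarrow> frechet_derivative \<psi> (at x) v =
      - ((1/4) *\<^sub>R cquad (\<lambda>i j. G x (nabla_vec C (\<lambda>y. E y i) x v) (E x j)) (\<psi> x))
      + K (cvec (\<lambda>i. G x v (E x i)) (\<psi> x))"
begin

lemma expand_G: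
  assumes x: "x \<in> U"
  shows "G x a b = (\<Sum>k\<in>UNIV. G x a (E x k) * G x b (E x k))"
proof -
  have lin: "linear (\<lambda>b. G x a b)" using bil_G[OF x] by (simp add: bilinear_def)
  have "G x a b = G x a (\<Sum>k\<in>UNIV. G x b (E x k) *\<^sub>R E x k)"
    using orthonormal_expansion[OF bil_G[OF x] orth_E[OF x], of b] by simp
  then show ?thesis by (simp add: linear_sum[OF lin] linear_scale[OF lin] mult.commute)
qed

lemma K_cquad: "K (cquad W w) = cquad W (K w)"
  by (simp add: cquad_def linear_sum[OF linear_K] linear_scale[OF linear_K] K_P)

lemma K_cvec: "K (cvec a w) = cvec a (K w)"
  by (simp add: cvec_def linear_sum[OF linear_K] linear_scale[OF linear_K] K_P)

text \<open>The connection matrix of \<open>C\<close> in the frame \<open>E\<close>, followed by the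
  frame components of \<open>v\<close>.\<close>

abbreviation "N y v \<equiv> \<lambda>i j. G y (nabla_vec C (\<lambda>z. E z i) y v) (E y j)"
abbreviation "\<theta> y v \<equiv> \<lambda>i. G y v (E y i)"

text \<open>Obtained by differentiating the constants \<open>G y (E y i) (E y j)\<close>.\<close>

lemma N_antisym:
  assumes x: "x \<in> U"
  shows "N x v j i = - N x v i j"
proof -
  have "((\<lambda>y. G y (E y i) (E y j)) has_derivative (\<lambda>u. N x u i j + N x u j i)) (at x)"
    using has_derivative_G_nabla[OF x diff_E[OF x] diff_E[OF x], of i j] by (simp add: sym_G[OF x, of "E x i"])
  then have "((\<lambda>y. if i = j then 1 else 0) has_derivative (\<lambda>u. N x u i j + N x u j i)) (at x)"
    by (rule has_derivative_cong_open[OF open_U x orth_E, THEN iffD1, rotated])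
  then have "(\<lambda>u. N x u i j + N x u j i) = (\<lambda>u. 0)"
    using has_derivative_unique[OF _ has_derivative_const] by blast
  then show ?thesis by (simp add: fun_eq_iff eq_neg_iff_add_eq_0 add.commute)
qed

text \<open>Expanding the product of two covariant derivatives in the frame exposes the product of
  connection matrices that cancels in the integrability condition.\<close>

lemma has_derivative_N:
  assumes x: "x \<in> U"
  shows "((\<lambda>y. N y v i j) has_derivative
    (\<lambda>u. G x (nabla_vec C (\<lambda>y. nabla_vec C (\<lambda>z. E z i) y v) x u) (E x j)
      + (\<Sum>k\<in>UNIV. N x v i k * N x u j k))) (at x)"
  using has_derivative_G_nabla[OF x differentiableI[OF nabla_vec_has_derivative[OF x diff_E diff2_E[OF x]]] diff_E[OF x], of i v j]
  unfolding expand_G[OF x, of "nabla_vec C (\<lambda>z. E z i) x v" "nabla_vec C (\<lambda>z. E z j) x u" for u] .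

lemma has_derivative_\<theta>:
  assumes x: "x \<in> U"
  shows "((\<lambda>y. \<theta> y v i) has_derivative
    (\<lambda>u. \<theta> x (C x u v) i + (\<Sum>k\<in>UNIV. \<theta> x v k * N x u i k))) (at x)"
  using has_derivative_G_nabla[OF x differentiable_const diff_E[OF x], of v i]
  unfolding nabla_vec_const expand_G[OF x, of v "nabla_vec C (\<lambda>z. E z i) x u" for u] .

text \<open>The Killing equation is differentiated once more and the two orders are compared by
  symmetry of the second derivatives of \<open>\<psi>\<close>. Second covariant derivatives of the
  frame give the curvature, the other connection matrices cancel, and the torsion comes from
  \<open>\<theta>\<close>, since the constant field \<open>v\<close> has covariant derivative
  \<open>C x u v\<close>.\<close>

theorem killing_integrability:
  assumes x: "x \<in> U"
  shows "(1/4) *\<^sub>R cquad (\<lambda>i j. G x (curv C x u v (E x i)) (E x j)) (\<psi> x)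
    = K (cvec (\<theta> x (C x u v - C x v u)) (\<psi> x))
      + K (K (cvec (\<theta> x v) (cvec (\<theta> x u) (\<psi> x)) - cvec (\<theta> x u) (cvec (\<theta> x v) (\<psi> x))))"
proof -
  let ?d = "\<lambda>u. frechet_derivative \<psi> (at x) u"
  let ?N' = "\<lambda>u v i j. G x (nabla_vec C (\<lambda>y. nabla_vec C (\<lambda>z. E z i) y v) x u) (E x j)"
  let ?NN = "\<lambda>u v i j. \<Sum>k\<in>UNIV. N x v i k * N x u j k"
  let ?\<theta>N = "\<lambda>u v i. \<Sum>k\<in>UNIV. \<theta> x v k * N x u i k"
  have d\<psi>: "(\<psi> has_derivative ?d) (at x)"
    using diff_\<psi>[OF x] by (simp add: frechet_derivative_works)
  have dq: "((\<lambda>y. cquad (N y v) (\<psi> y)) has_derivative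
     (\<lambda>u. cquad (\<lambda>i j. ?N' u v i j + ?NN u v i j) (\<psi> x) + cquad (N x v) (?d u))) (at x)" for v
    by (rule has_derivative_cquad[OF has_derivative_N[OF x] d\<psi>])
  have dv: "((\<lambda>y. K (cvec (\<theta> y v) (\<psi> y))) has_derivative
     (\<lambda>u. K (cvec (\<lambda>i. \<theta> x (C x u v) i + ?\<theta>N u v i) (\<psi> x) + cvec (\<theta> x v) (?d u)))) (at x)" for v
    by (rule bounded_linear.has_derivative[OF linear_K[unfolded linear_conv_bounded_linear]
        has_derivative_cvec[OF has_derivative_\<theta>[OF x] d\<psi>]])
  have dd: "((\<lambda>y. frechet_derivative \<psi> (at y) v) has_derivative
     (\<lambda>u. - ((1/4) *\<^sub>R (cquad (\<lambda>i j. ?N' u v i j + ?NN u v i j) (\<psi> x) + cquad (N x v) (?d u)))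
       + K (cvec (\<lambda>i. \<theta> x (C x u v) i + ?\<theta>N u v i) (\<psi> x) + cvec (\<theta> x v) (?d u)))) (at x)" for v
    by (rule has_derivative_cong_open[OF open_U x killing, THEN iffD2], assumption)
       (intro has_derivative_add has_derivative_minus has_derivative_scaleR_right dq dv)
  have "frechet_derivative (\<lambda>y. frechet_derivative \<psi> (at y) v) (at x) u
      = frechet_derivative (\<lambda>y. frechet_derivative \<psi> (at y) u) (at x) v"
    by (rule second_derivative_symmetric[OF open_U x diff_\<psi> differentiableI[OF dd]])
  then have sym: "- ((1/4) *\<^sub>R (cquad (\<lambda>i j. ?N' u v i j + ?NN u v i j) (\<psi> x) + cquad (N x v) (?d u)))
       + K (cvec (\<lambda>i. \<theta> x (C x u v) i + ?\<theta>N u v i) (\<psi> x) + cvec (\<theta> x v) (?d u))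
     = - ((1/4) *\<^sub>R (cquad (\<lambda>i j. ?N' v u i j + ?NN v u i j) (\<psi> x) + cquad (N x u) (?d v)))
       + K (cvec (\<lambda>i. \<theta> x (C x v u) i + ?\<theta>N v u i) (\<psi> x) + cvec (\<theta> x u) (?d v))"
    unfolding frechet_derivative_at[OF dd, symmetric] .
  have ric: "nabla_vec C (\<lambda>y. nabla_vec C (\<lambda>z. E z i) y v) x u - nabla_vec C (\<lambda>y. nabla_vec C (\<lambda>z. E z i) y u) x v
      = curv C x u v (E x i)" for i
    by (rule ricci_identity[OF x diff_E diff2_E[OF x]])
  have R: "cquad (?N' u v) (\<psi> x) - cquad (?N' v u) (\<psi> x)
      = cquad (\<lambda>i j. G x (curv C x u v (E x i)) (E x j)) (\<psi> x)"
    unfolding cquad_diff[symmetric] ric[symmetric] by (simp add: bilinear_lsub[OF bil_G[OF x]])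
  \<comment> \<open>The quadratic terms in the derivative of \<open>N\<close> match the commutator
    of the two spin actions.\<close>
  have qq: "cquad (N x v) (cquad (N x u) (\<psi> x)) - cquad (N x u) (cquad (N x v) (\<psi> x))
      = 4 *\<^sub>R (cquad (?NN u v) (\<psi> x) - cquad (?NN v u) (\<psi> x))"
  proof -
    have "(\<Sum>k\<in>UNIV. N x u i k * N x v k j - N x v i k * N x u k j) = ?NN u v i j - ?NN v u i j" for i j
      unfolding sum_subtractf[symmetric]
      by (intro sum.cong refl) (simp add: N_antisym[OF x, of _ _ j])
    then show ?thesis
      unfolding cquad_cquad_commutator[OF N_antisym[OF x]] cquad_diff[symmetric] by simp
  qed
  \<comment> \<open>Moving the spin action past a vector costs exactly the frame derivative
    contained in \<open>\<theta>\<close>, so these terms cancel in the comparison.\<close>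
  have qv: "cquad (N x v) (cvec (\<theta> x u) w) = cvec (\<theta> x u) (cquad (N x v) w) - 4 *\<^sub>R cvec (?\<theta>N v u) w" for u v w
  proof -
    have "(\<Sum>k\<in>UNIV. \<theta> x u k * N x v k j) = - ?\<theta>N v u j" for j
      unfolding sum_negf[symmetric]
      by (intro sum.cong refl) (simp add: N_antisym[OF x, of _ _ j])
    then have "cquad (N x v) (cvec (\<theta> x u) w) - cvec (\<theta> x u) (cquad (N x v) w)
        = 4 *\<^sub>R cvec (\<lambda>j. - 1 * ?\<theta>N v u j) w"
      unfolding cquad_cvec_commutator[OF N_antisym[OF x]] by simp
    then show ?thesis unfolding cvec_scale by (simp add: algebra_simps)
  qed
  have tor: "cvec (\<theta> x (C x u v - C x v u)) (\<psi> x) = cvec (\<theta> x (C x u v)) (\<psi> x) - cvec (\<theta> x (C x v u)) (\<psi> x)"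
    unfolding cvec_diff[symmetric] by (simp add: bilinear_lsub[OF bil_G[OF x]])
  note lin = linear_add[OF linear_cquad] linear_scale[OF linear_cquad] linear_diff[OF linear_cquad] linear_neg[OF linear_cquad]
    linear_add[OF linear_cvec] linear_scale[OF linear_cvec] linear_diff[OF linear_cvec] linear_neg[OF linear_cvec]
    linear_add[OF linear_K] linear_scale[OF linear_K] linear_diff[OF linear_K] linear_neg[OF linear_K]
  define \<phi> where "\<phi> = \<psi> x"
  note qq' = qq[folded \<phi>_def, unfolded scaleR_diff_right diff_eq_eq]
  show ?thesis
    using sym unfolding killing[OF x] R[symmetric] tor cquad_add cvec_add
    unfolding \<phi>_def[symmetric]
    by (simp add: lin K_cquad K_cvec qv qq' algebra_simps)
qed

end

section \<open>Sasakian structures in a chart\<close>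

text \<open>\<open>\<Gamma>\<close> is the Levi-Civita connection and \<open>D\<close> the
  characteristic one, both metric for the same \<open>G\<close>.\<close>

locale sasaki_patch = LC: metric_patch U \<Gamma> G + metric_patch U D G
  for U :: "(real^'n::finite) set" and \<Gamma> D G +
  fixes \<xi> :: "real^'n \<Rightarrow> real^'n" and \<eta> :: "real^'n \<Rightarrow> real^'n \<Rightarrow> real"
    and \<phi> :: "real^'n \<Rightarrow> real^'n \<Rightarrow> real^'n"
  assumes torsion_free: "x \<in> U \<Longrightarrow> \<Gamma> x u v = \<Gamma> x v u"
    and skew_torsion_D: "x \<in> U \<Longrightarrow> G x (D x u w - D x w u) v = - G x (D x u v - D x v u) w"
    and diff_\<xi>: "x \<in> U \<Longrightarrow> \<xi> differentiable (at x)"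
    and lin_\<eta>: "x \<in> U \<Longrightarrow> linear (\<eta> x)"
    and diff_\<eta>: "x \<in> U \<Longrightarrow> (\<lambda>y. \<eta> y v) differentiable (at x)"
    and lin_\<phi>: "x \<in> U \<Longrightarrow> linear (\<phi> x)"
    and diff_\<phi>: "x \<in> U \<Longrightarrow> (\<lambda>y. \<phi> y v) differentiable (at x)"
    and \<eta>_\<xi>: "x \<in> U \<Longrightarrow> \<eta> x (\<xi> x) = 1"
    and \<phi>_\<phi>: "x \<in> U \<Longrightarrow> \<phi> x (\<phi> x u) = - u + \<eta> x u *\<^sub>R \<xi> x"
    and G_\<phi>_\<phi>: "x \<in> U \<Longrightarrow> G x (\<phi> x u) (\<phi> x v) = G x u v - \<eta> x u * \<eta> x v"
    and contact: "x \<in> U \<Longrightarrow> ext_deriv \<eta> x u v = 2 * G x u (\<phi> x v)"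
    and parallel_\<xi>: "x \<in> U \<Longrightarrow> nabla_vec D \<xi> x u = 0"
    and parallel_\<eta>: "x \<in> U \<Longrightarrow> nabla_form D \<eta> x u v = 0"
    and parallel_\<phi>: "x \<in> U \<Longrightarrow> nabla_endo D \<phi> x u v = 0"
begin

section \<open>Torsion of the characteristic connection\<close>

definition T :: "real^'n \<Rightarrow> real^'n \<Rightarrow> real^'n \<Rightarrow> real^'n" where
  "T x u v = D x u v - D x v u"

text \<open>The fundamental 2-form; by \<open>contact\<close> it is half the exterior derivative of
  \<open>\<eta>\<close>.\<close>

abbreviation "F x u v \<equiv> G x u (\<phi> x v)"

lemma nondegenerate:
  assumes x: "x \<in> U" and "\<And>w. G x a w = G x b w"
  shows "a = b"
proof (rule ccontr)
  assume "a \<noteq> b"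
  then have "G x (a - b) (a - b) > 0" by (intro pos_G x) simp
  then show False using assms(2)[of "a - b"] by (simp add: bilinear_lsub[OF bil_G[OF x]])
qed

text \<open>The lowered difference \<open>S\<close> of the two sides is symmetric in its first two
  slots and skew in its last two, which forces it to vanish.\<close>

lemma D_eq_LC_plus_T:
  assumes x: "x \<in> U"
  shows "D x u v = \<Gamma> x u v + (1/2) *\<^sub>R T x u v"
proof (rule nondegenerate[OF x])
  fix w
  define S where "S u v w = G x (D x u v) w - G x (\<Gamma> x u v) w - (1/2) * G x (T x u v) w" for u v w
  note bl = bilinear_ladd[OF bil_G[OF x]] bilinear_lsub[OF bil_G[OF x]] bilinear_lmul[OF bil_G[OF x]]
  have s1: "S u v w = S v u w" for u v w
    using torsion_free[OF x, of u v] by (simp add: S_def T_def bl field_simps)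
  have s2: "S u v w = - S u w v" for u v w
  proof -
    have "G x (D x u v) w + G x v (D x u w) = G x (\<Gamma> x u v) w + G x v (\<Gamma> x u w)"
      using metric_C[OF x, of v w u] LC.metric_C[OF x, of v w u] by simp
    then show ?thesis
      using skew_torsion_D[OF x, of u w v] sym_G[OF x, of v]
      by (simp add: S_def T_def)
  qed
  have "S u v w = 0"
    using s1[of u v w] s2[of v u w] s1[of v w u] s2[of w v u] s1[of w u v] s2[of u w v] by linarith
  then show "G x (D x u v) w = G x (\<Gamma> x u v + (1/2) *\<^sub>R T x u v) w"
    by (simp add: S_def bl)
qed

text \<open>The square of \<open>\<phi>\<close> kills \<open>\<xi>\<close>, so the formula for the
  square applied to \<open>\<phi> x (\<xi> x)\<close> makes this vector a multiple of
  \<open>\<xi> x\<close>; one more application of \<open>\<phi>\<close> makes it zero.\<close>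

lemma \<phi>_\<xi>:
  assumes x: "x \<in> U" shows "\<phi> x (\<xi> x) = 0"
proof -
  have 0: "\<phi> x (\<phi> x (\<xi> x)) = 0" by (simp add: \<phi>_\<phi>[OF x] \<eta>_\<xi>[OF x])
  have 1: "\<phi> x (\<xi> x) = \<eta> x (\<phi> x (\<xi> x)) *\<^sub>R \<xi> x"
    using \<phi>_\<phi>[OF x, of "\<phi> x (\<xi> x)"] by (simp add: 0 linear_0[OF lin_\<phi>[OF x]])
  have "\<eta> x (\<phi> x (\<xi> x)) *\<^sub>R \<phi> x (\<xi> x) = 0"
    using 0 1 linear_scale[OF lin_\<phi>[OF x]] by metis
  then show ?thesis using 1 by force
qed

text \<open>The cube of \<open>\<phi>\<close> is computed in two ways.\<close>

lemma \<eta>_\<phi>: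
  assumes x: "x \<in> U" shows "\<eta> x (\<phi> x v) = 0"
proof -
  have ne: "\<xi> x \<noteq> 0" using \<eta>_\<xi>[OF x] linear_0[OF lin_\<eta>[OF x]] by auto
  have "\<phi> x (- v + \<eta> x v *\<^sub>R \<xi> x) = - \<phi> x v"
    by (simp add: linear_add[OF lin_\<phi>[OF x]] linear_diff[OF lin_\<phi>[OF x]] linear_neg[OF lin_\<phi>[OF x]] linear_scale[OF lin_\<phi>[OF x]] \<phi>_\<xi>[OF x])
  then have "- \<phi> x v + \<eta> x (\<phi> x v) *\<^sub>R \<xi> x = - \<phi> x v"
    using \<phi>_\<phi>[OF x, of "\<phi> x v"] by (simp add: \<phi>_\<phi>[OF x, of v])
  then show ?thesis using ne by simp
qed

lemma G_\<xi>:
  assumes x: "x \<in> U" shows "G x v (\<xi> x) = \<eta> x v" "G x (\<xi> x) v = \<eta> x v"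
  using G_\<phi>_\<phi>[OF x, of v "\<xi> x"] sym_G[OF x, of v "\<xi> x"]
  by (simp_all add: \<phi>_\<xi>[OF x] \<eta>_\<xi>[OF x] bilinear_rzero[OF bil_G[OF x]])

lemma F_antisym: "x \<in> U \<Longrightarrow> F x v u = - F x u v"
  using contact[of x u v] contact[of x v u] by (simp add: ext_deriv_def)

lemma \<phi>_skew: "x \<in> U \<Longrightarrow> G x (\<phi> x u) v = - G x u (\<phi> x v)"
  using F_antisym[of x u v] sym_G[of x "\<phi> x u" v] by simp

lemma d\<eta>: "x \<in> U \<Longrightarrow> frechet_derivative (\<lambda>y. \<eta> y v) (at x) u = \<eta> x (D x u v)"
  using parallel_\<eta>[of x u v] by (simp add: nabla_form_def)

text \<open>For a parallel 1-form the exterior derivative is the form applied to the torsion;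
  \<open>contact\<close> evaluates it.\<close>

lemma T_\<xi>: "x \<in> U \<Longrightarrow> G x (T x u v) (\<xi> x) = 2 * F x u v"
  using contact[of x u v] by (simp add: ext_deriv_def d\<eta> T_def G_\<xi> linear_diff[OF lin_\<eta>])

lemma T_antisym: "T x v u = - T x u v"
  by (simp add: T_def)

lemma T_skew: "x \<in> U \<Longrightarrow> G x (T x u w) v = - G x (T x u v) w"
  unfolding T_def by (rule skew_torsion_D)

lemma bil_T: "x \<in> U \<Longrightarrow> bilinear (T x)"
  using linear_C[of x] unfolding bilinear_def T_def by (auto intro!: linear_compose_sub)

text \<open>A parallel tensor is differentiated by differentiating its arguments covariantly; this
  lemma and the next three are the coordinate form of that rule for \<open>\<phi>\<close>,
  \<open>\<eta>\<close>, \<open>\<xi>\<close> and \<open>F\<close>.\<close>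

lemma has_derivative_\<phi>:
  assumes x: "x \<in> U" and X: "X differentiable (at x)"
  shows "((\<lambda>y. \<phi> y (X y)) has_derivative (\<lambda>u. \<phi> x (nabla_vec D X x u) - D x u (\<phi> x (X x)))) (at x)"
proof -
  have fd: "frechet_derivative (\<lambda>y. \<phi> y v) (at x) u = \<phi> x (D x u v) - D x u (\<phi> x v)" for u v
    using parallel_\<phi>[OF x, of u v] by (simp add: nabla_endo_def algebra_simps)
  show ?thesis
    using has_derivative_linear_field[OF open_U x lin_\<phi> diff_\<phi>[OF x] X[unfolded frechet_derivative_works]]
    unfolding fd nabla_vec_def linear_add[OF lin_\<phi>[OF x]] by (simp add: algebra_simps)
qed

lemma has_derivative_\<eta>:
  assumes x: "x \<in> U" and X: "X differentiable (at x)"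
  shows "((\<lambda>y. \<eta> y (X y)) has_derivative (\<lambda>u. \<eta> x (nabla_vec D X x u))) (at x)"
  using has_derivative_linear_field[OF open_U x lin_\<eta> diff_\<eta>[OF x] X[unfolded frechet_derivative_works]]
  by (simp add: nabla_vec_def linear_add[OF lin_\<eta>[OF x]] d\<eta>[OF x] add.commute)

lemma has_derivative_\<xi>:
  assumes x: "x \<in> U"
  shows "(\<xi> has_derivative (\<lambda>u. - D x u (\<xi> x))) (at x)"
proof -
  have "frechet_derivative \<xi> (at x) u = - D x u (\<xi> x)" for u
    using parallel_\<xi>[OF x, of u] by (simp add: nabla_vec_def eq_neg_iff_add_eq_0)
  then have "frechet_derivative \<xi> (at x) = (\<lambda>u. - D x u (\<xi> x))" by blast
  then show ?thesis using diff_\<xi>[OF x, unfolded frechet_derivative_works] by simp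
qed

lemma has_derivative_F:
  assumes x: "x \<in> U"
  shows "((\<lambda>y. F y v w) has_derivative (\<lambda>u. F x (D x u v) w + F x v (D x u w))) (at x)"
  using has_derivative_G[OF x has_derivative_const[of v] has_derivative_\<phi>[OF x differentiable_const[of w]]]
  by (simp add: nabla_vec_const)

text \<open>Closedness of the exterior derivative of \<open>\<eta>\<close>. As \<open>F\<close> is
  parallel, its derivatives contribute only Christoffel terms, which the cyclic sum combines into
  torsion.\<close>

lemma d_d\<eta>:
  assumes x: "x \<in> U"
  shows "F x (T x u v) w + F x (T x v w) u + F x (T x w u) v = 0"
proof -
  \<comment> \<open>\<open>H v u w\<close> is the second derivative of the component
    \<open>\<eta> y v\<close> along \<open>u\<close> and \<open>w\<close>.\<close>
  define H where "H v u = frechet_derivative (\<lambda>y. frechet_derivative (\<lambda>z. \<eta> z v) (at y) u) (at x)" for u v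
  have h: "((\<lambda>y. frechet_derivative (\<lambda>z. \<eta> z v) (at y) u) has_derivative
      (\<lambda>h. \<eta> x (nabla_vec D (\<lambda>y. D y u v) x h))) (at x)" for u v
    by (rule has_derivative_cong_open[OF open_U x d\<eta>, THEN iffD2, OF _ has_derivative_\<eta>[OF x diff_C[OF x]]])
  have sym: "H v u w = H v w u" for u v w
    unfolding H_def by (rule second_derivative_symmetric[OF open_U x diff_\<eta> differentiableI[OF h]])
  have 2: "((\<lambda>y. 2 * F y u v) has_derivative (\<lambda>h. H v u h - H u v h)) (at x)" for u v
    by (rule has_derivative_cong_open[OF open_U x contact[symmetric], THEN iffD2], assumption)
       (unfold ext_deriv_def H_def, intro has_derivative_diff differentiableI[OF h, unfolded frechet_derivative_works])
  have 3: "((\<lambda>y. 2 * F y u v) has_derivative (\<lambda>h. 2 * (F x (D x h u) v + F x u (D x h v)))) (at x)" for u v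
    by (intro has_derivative_mult_right has_derivative_F[OF x])
  have eq: "2 * (F x (D x w u) v + F x u (D x w v)) = H v u w - H u v w" for u v w
    using fun_cong[OF has_derivative_unique[OF 3 2], of w] by simp
  have FT: "F x (T x a b) c = F x (D x a b) c - F x (D x b a) c" for a b c
    by (simp add: T_def bilinear_lsub[OF bil_G[OF x]])
  show ?thesis
    using eq[of w u v] eq[of u v w] eq[of v w u] sym[of u v w] sym[of v w u] sym[of w u v]
      F_antisym[OF x, of u "D x w v"] F_antisym[OF x, of v "D x u w"] F_antisym[OF x, of w "D x v u"]
    unfolding FT by argo
qed

text \<open>
  The identity \<open>d (d\<eta>) = 0\<close> says that the derivation of 3-forms induced by \<open>\<phi>\<close> kills the horizontal part of
  the torsion; this derivation has the nonzero eigenvalues \<open>\<plusminus>\<i>, \<plusminus>3\<i>\<close> there.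
\<close>

lemma T_horizontal:
  assumes x: "x \<in> U" and u: "\<eta> x u = 0" and v: "\<eta> x v = 0" and w: "\<eta> x w = 0"
  shows "G x (T x u v) w = 0"
proof -
  define t where "t a b c = G x (T x a b) c" for a b c
  have t1: "t b a c = - t a b c" for a b c
    by (simp add: t_def T_antisym[of x b] bilinear_lneg[OF bil_G[OF x]])
  have t2: "t a c b = - t a b c" for a b c
    unfolding t_def by (rule T_skew[OF x])
  have L: "t a b (\<phi> x c) + t b c (\<phi> x a) + t c a (\<phi> x b) = 0" for a b c
    using d_d\<eta>[OF x, of a b c] by (simp add: t_def)
  have pp: "\<phi> x (\<phi> x a) = - a" if "\<eta> x a = 0" for a
    using that by (simp add: \<phi>_\<phi>[OF x])
  have tn: "t a b (- c) = - t a b c" for a b c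
    by (simp add: t_def bilinear_rneg[OF bil_G[OF x]])
  \<comment> \<open>The three instances of \<open>L\<close> with two arguments rotated by
    \<open>\<phi>\<close> add up to three times this term minus twice the instance for
    \<open>a\<close>, \<open>b\<close>, \<open>c\<close>; \<open>t1\<close> and \<open>t2\<close>
    supply the reorderings.\<close>
  have N: "t (\<phi> x a) (\<phi> x b) (\<phi> x c) = 0" if h: "\<eta> x a = 0" "\<eta> x b = 0" "\<eta> x c = 0" for a b c
    using L[of "\<phi> x a" "\<phi> x b" c] L[of "\<phi> x b" "\<phi> x c" a] L[of "\<phi> x c" "\<phi> x a" b] L[of a b c]
      t1[of "\<phi> x b" c a] t2[of "\<phi> x b" c a] t1[of "\<phi> x b" a c] t2[of "\<phi> x b" a c]
      t1[of a "\<phi> x b" c] t1[of c "\<phi> x b" a] t2[of c "\<phi> x b" a] t2[of a "\<phi> x b" c]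
      t1[of "\<phi> x a" c b] t2[of "\<phi> x a" c b] t1[of "\<phi> x a" b c] t2[of "\<phi> x a" b c]
      t1[of b "\<phi> x a" c] t1[of c "\<phi> x a" b] t2[of c "\<phi> x a" b] t2[of b "\<phi> x a" c]
      t1[of "\<phi> x c" a b] t2[of "\<phi> x c" a b] t1[of "\<phi> x c" b a] t2[of "\<phi> x c" b a]
      t1[of b "\<phi> x c" a] t1[of a "\<phi> x c" b] t2[of a "\<phi> x c" b] t2[of b "\<phi> x c" a]
      t1[of "\<phi> x b" "\<phi> x c" "\<phi> x a"] t2[of "\<phi> x b" "\<phi> x c" "\<phi> x a"]
      t1[of "\<phi> x a" "\<phi> x c" "\<phi> x b"] t2[of "\<phi> x a" "\<phi> x c" "\<phi> x b"]
      t1[of "\<phi> x c" "\<phi> x a" "\<phi> x b"] t2[of "\<phi> x c" "\<phi> x a" "\<phi> x b"]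
    unfolding pp[OF h(1)] pp[OF h(2)] pp[OF h(3)] tn by linarith
  have "t (\<phi> x (\<phi> x u)) (\<phi> x (\<phi> x v)) (\<phi> x (\<phi> x w)) = 0"
    by (rule N) (simp_all add: \<eta>_\<phi>[OF x])
  then show ?thesis
    unfolding pp[OF u] pp[OF v] pp[OF w] t_def
    by (simp add: bilinear_lneg[OF bil_T[OF x]] bilinear_rneg[OF bil_T[OF x]] bilinear_rneg[OF bil_G[OF x]])
qed

text \<open>The right-hand side is the wedge product of \<open>\<eta>\<close> and its exterior
  derivative, with one slot raised. Each argument splits into a horizontal part \<open>h\<close> and
  a multiple of \<open>\<xi>\<close>: purely horizontal values vanish by
  \<open>T_horizontal\<close>, the others follow from \<open>T_\<xi>\<close> and skewness.\<close>

lemma T_eq: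
  assumes x: "x \<in> U"
  shows "T x u v = 2 *\<^sub>R (F x u v *\<^sub>R \<xi> x - \<eta> x u *\<^sub>R \<phi> x v + \<eta> x v *\<^sub>R \<phi> x u)"
proof (rule nondegenerate[OF x])
  fix w
  define h where "h a = a - \<eta> x a *\<^sub>R \<xi> x" for a
  have hh: "\<eta> x (h a) = 0" for a
    by (simp add: h_def linear_diff[OF lin_\<eta>[OF x]] linear_scale[OF lin_\<eta>[OF x]] \<eta>_\<xi>[OF x])
  note Tb = bilinear_ladd[OF bil_T[OF x]] bilinear_radd[OF bil_T[OF x]] bilinear_lmul[OF bil_T[OF x]]
    bilinear_rmul[OF bil_T[OF x]] bilinear_lsub[OF bil_T[OF x]] bilinear_rsub[OF bil_T[OF x]]
  note Gb = bilinear_ladd[OF bil_G[OF x]] bilinear_radd[OF bil_G[OF x]] bilinear_lmul[OF bil_G[OF x]]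
    bilinear_rmul[OF bil_G[OF x]] bilinear_lsub[OF bil_G[OF x]] bilinear_rsub[OF bil_G[OF x]]
    bilinear_lneg[OF bil_G[OF x]] bilinear_rneg[OF bil_G[OF x]] bilinear_lzero[OF bil_G[OF x]] bilinear_rzero[OF bil_G[OF x]]
  have T1: "G x (T x a (\<xi> x)) b = - 2 * F x a b" for a b
    using T_skew[OF x, of a "\<xi> x" b] T_\<xi>[OF x, of a b] by simp
  have T2: "G x (T x (\<xi> x) a) b = 2 * F x a b" for a b
    using T1[of a b] T_antisym[of x "\<xi> x" a] by (simp add: Gb)
  have \<eta>_T: "\<eta> x (T x a b) = 2 * F x a b" for a b
    using T_\<xi>[OF x] by (simp add: G_\<xi>[OF x])
  have "G x (T x (h u) (h v)) (h w) = 0"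
    by (rule T_horizontal[OF x hh hh hh])
  then show "G x (T x u v) w = G x (2 *\<^sub>R (F x u v *\<^sub>R \<xi> x - \<eta> x u *\<^sub>R \<phi> x v + \<eta> x v *\<^sub>R \<phi> x u)) w"
    unfolding h_def
    by (simp add: Tb Gb T1 T2 \<eta>_T G_\<xi>[OF x] \<phi>_\<xi>[OF x] \<eta>_\<phi>[OF x] \<phi>_skew[OF x] \<eta>_\<xi>[OF x]
        linear_add[OF lin_\<eta>[OF x]] linear_diff[OF lin_\<eta>[OF x]] linear_scale[OF lin_\<eta>[OF x]] algebra_simps)
qed

text \<open>By \<open>T_eq\<close> the torsion is built from \<open>G\<close>,
  \<open>\<phi>\<close>, \<open>\<eta>\<close> and \<open>\<xi>\<close>, all parallel for
  \<open>D\<close>.\<close>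

lemma parallel_T:
  assumes x: "x \<in> U"
  shows "((\<lambda>y. T y v w) has_derivative
    (\<lambda>u. T x (D x u v) w + T x v (D x u w) - D x u (T x v w))) (at x)"
proof -
  have d\<phi>: "((\<lambda>y. \<phi> y a) has_derivative (\<lambda>u. \<phi> x (D x u a) - D x u (\<phi> x a))) (at x)" for a
    using has_derivative_\<phi>[OF x differentiable_const[of a]] by (simp add: nabla_vec_const)
  have d\<eta>': "((\<lambda>y. \<eta> y a) has_derivative (\<lambda>u. \<eta> x (D x u a))) (at x)" for a
    using has_derivative_\<eta>[OF x differentiable_const[of a]] by (simp add: nabla_vec_const)
  note D = linear_add[OF linear_C(2)[OF x]] linear_diff[OF linear_C(2)[OF x]] linear_scale[OF linear_C(2)[OF x]]
  have "((\<lambda>y. 2 *\<^sub>R (F y v w *\<^sub>R \<xi> y - \<eta> y v *\<^sub>R \<phi> y w + \<eta> y w *\<^sub>R \<phi> y v)) has_derivative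
    (\<lambda>u. 2 *\<^sub>R ((F x v w *\<^sub>R (- D x u (\<xi> x)) + (F x (D x u v) w + F x v (D x u w)) *\<^sub>R \<xi> x)
       - (\<eta> x v *\<^sub>R (\<phi> x (D x u w) - D x u (\<phi> x w)) + \<eta> x (D x u v) *\<^sub>R \<phi> x w)
       + (\<eta> x w *\<^sub>R (\<phi> x (D x u v) - D x u (\<phi> x v)) + \<eta> x (D x u w) *\<^sub>R \<phi> x v)))) (at x)"
    by (intro has_derivative_scaleR_right has_derivative_add has_derivative_diff has_derivative_scaleR
        has_derivative_F[OF x] d\<phi> d\<eta>' has_derivative_\<xi>[OF x])
  then have "((\<lambda>y. T y v w) has_derivative
    (\<lambda>u. 2 *\<^sub>R ((F x v w *\<^sub>R (- D x u (\<xi> x)) + (F x (D x u v) w + F x v (D x u w)) *\<^sub>R \<xi> x)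
       - (\<eta> x v *\<^sub>R (\<phi> x (D x u w) - D x u (\<phi> x w)) + \<eta> x (D x u v) *\<^sub>R \<phi> x w)
       + (\<eta> x w *\<^sub>R (\<phi> x (D x u v) - D x u (\<phi> x v)) + \<eta> x (D x u w) *\<^sub>R \<phi> x v)))) (at x)"
    by (rule has_derivative_cong_open[OF open_U x T_eq, THEN iffD2, rotated])
  then show ?thesis
    by (simp add: T_eq[OF x] D algebra_simps)
qed

text \<open>The term linear in \<open>a\<close> is the covariant exterior derivative of the torsion:
  its derivative part vanishes as \<open>T\<close> is parallel, and the rest arises because
  \<open>D\<close> itself has torsion \<open>T\<close>. The values -1/2 and 1/2 of \<open>a\<close>
  give \<open>\<Gamma>\<close> and the connection \<open>D'\<close> below.\<close>

lemma curv_add_parallel_torsion: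
  assumes x: "x \<in> U" and C: "\<And>y u v. y \<in> U \<Longrightarrow> C y u v = D y u v + a *\<^sub>R T y u v"
  shows "curv C x u v w = curv D x u v w + a *\<^sub>R T x (T x u v) w
     + (a * a) *\<^sub>R (T x u (T x v w) - T x v (T x u w))"
proof -
  have "((\<lambda>y. D y v w + a *\<^sub>R T y v w) has_derivative
     (\<lambda>u. frechet_derivative (\<lambda>y. D y v w) (at x) u
        + a *\<^sub>R (T x (D x u v) w + T x v (D x u w) - D x u (T x v w)))) (at x)" for v w
    by (intro has_derivative_add has_derivative_scaleR_right parallel_T[OF x] diff_C[OF x, unfolded frechet_derivative_works])
  then have "((\<lambda>y. C y v w) has_derivative
     (\<lambda>u. frechet_derivative (\<lambda>y. D y v w) (at x) u
        + a *\<^sub>R (T x (D x u v) w + T x v (D x u w) - D x u (T x v w)))) (at x)" for v w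
    by (rule has_derivative_cong_open[OF open_U x C, THEN iffD2, rotated])
  from frechet_derivative_at[OF this, symmetric]
  have fd: "frechet_derivative (\<lambda>y. C y v w) (at x) u = frechet_derivative (\<lambda>y. D y v w) (at x) u
        + a *\<^sub>R (T x (D x u v) w + T x v (D x u w) - D x u (T x v w))" for u v w by simp
  note D = linear_add[OF linear_C(2)[OF x]] linear_diff[OF linear_C(2)[OF x]] linear_scale[OF linear_C(2)[OF x]]
    bilinear_radd[OF bil_T[OF x]] bilinear_rmul[OF bil_T[OF x]]
  have TT: "T x (T x u v) w = T x (D x u v) w - T x (D x v u) w"
    using bilinear_lsub[OF bil_T[OF x]] by (simp add: T_def[of x u v])
  show ?thesis
    unfolding curv_def nabla_vec_def fd C[OF x] TT by (simp add: D algebra_simps)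
qed

text \<open>The Ricci identity for a parallel field.\<close>

lemma curv_D_\<xi>:
  assumes x: "x \<in> U"
  shows "curv D x u v (\<xi> x) = 0"
proof -
  have z: "nabla_vec D (\<lambda>y. nabla_vec D \<xi> y v) x u = 0" for u v
  proof -
    have "((\<lambda>y. nabla_vec D \<xi> y v) has_derivative (\<lambda>_. 0)) (at x)"
      by (rule has_derivative_cong_open[OF open_U x parallel_\<xi>, THEN iffD2]) simp_all
    from frechet_derivative_at[OF this, symmetric] show ?thesis
      by (simp add: nabla_vec_def[of D "\<lambda>y. nabla_vec D \<xi> y v"] parallel_\<xi>[OF x] bilinear_rzero[OF bil_C[OF x]])
  qed
  \<comment> \<open>The second differentiability of \<open>\<xi>\<close> that the Ricci identity
    asks for is read off from the parallel equation.\<close>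
  have "frechet_derivative \<xi> (at y) v = - D y v (\<xi> y)" if "y \<in> U" for y v
    using frechet_derivative_at[OF has_derivative_\<xi>[OF that]] by metis
  then have "(\<lambda>y. frechet_derivative \<xi> (at y) v) differentiable (at x) \<longleftrightarrow> (\<lambda>y. - D y v (\<xi> y)) differentiable (at x)" for v
    by (rule differentiable_cong_open[OF open_U x])
  moreover have "(\<lambda>y. - D y v (\<xi> y)) differentiable (at x)" for v
    by (intro differentiable_minus differentiableI[OF has_derivative_C[OF x has_derivative_const has_derivative_\<xi>[OF x]]])
  ultimately show ?thesis
    using ricci_identity[OF x diff_\<xi>, of v u] z by simp
qed

text \<open>A parallel \<open>\<phi>\<close> commutes with both covariant derivatives, hence with
  their commutator; the Ricci identity is applied to the field \<open>\<phi> y w\<close>.\<close>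

lemma curv_D_\<phi>:
  assumes x: "x \<in> U"
  shows "curv D x u v (\<phi> x w) = \<phi> x (curv D x u v w)"
proof -
  have nab: "nabla_vec D (\<lambda>y. \<phi> y w) y v = \<phi> y (D y v w)" if "y \<in> U" for y v
    using parallel_\<phi>[OF that, of v w] by (simp add: nabla_vec_def nabla_endo_def)
  have fd: "frechet_derivative (\<lambda>y. \<phi> y w) (at y) v = \<phi> y (D y v w) - D y v (\<phi> y w)" if "y \<in> U" for y v
    using nab[OF that, of v] by (simp add: nabla_vec_def algebra_simps)
  have h: "((\<lambda>y. \<phi> y (D y v w)) has_derivative
      (\<lambda>u. \<phi> x (nabla_vec D (\<lambda>y. D y v w) x u) - D x u (\<phi> x (D x v w)))) (at x)" for v
    by (rule has_derivative_\<phi>[OF x diff_C[OF x]])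
  have z: "nabla_vec D (\<lambda>y. nabla_vec D (\<lambda>y. \<phi> y w) y v) x u = \<phi> x (nabla_vec D (\<lambda>y. D y v w) x u)" for u v
  proof -
    have "((\<lambda>y. nabla_vec D (\<lambda>y. \<phi> y w) y v) has_derivative
      (\<lambda>u. \<phi> x (nabla_vec D (\<lambda>y. D y v w) x u) - D x u (\<phi> x (D x v w)))) (at x)"
      by (rule has_derivative_cong_open[OF open_U x nab, THEN iffD2, rotated, OF h])
    from frechet_derivative_at[OF this, symmetric] show ?thesis
      by (simp add: nabla_vec_def[of D "\<lambda>y. nabla_vec D (\<lambda>y. \<phi> y w) y v"] nab[OF x])
  qed
  have "(\<lambda>y. \<phi> y (D y v w) - D y v (\<phi> y w)) differentiable (at x)" for v
    using diff_\<phi>[OF x, of w, unfolded frechet_derivative_works]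
    by (intro differentiable_diff differentiableI[OF h] differentiableI[OF has_derivative_C[OF x has_derivative_const]])
  then have "(\<lambda>y. frechet_derivative (\<lambda>y. \<phi> y w) (at y) v) differentiable (at x)" for v
    by (rule differentiable_cong_open[OF open_U x fd, THEN iffD2, rotated])
  from ricci_identity[OF x diff_\<phi> this, of v u]
  show ?thesis unfolding z by (simp add: curv_def linear_diff[OF lin_\<phi>[OF x]])
qed

lemma bianchi_LC:
  assumes x: "x \<in> U"
  shows "curv \<Gamma> x u v w + curv \<Gamma> x v w u + curv \<Gamma> x w u v = 0"
proof -
  have "frechet_derivative (\<lambda>y. \<Gamma> y a b) (at x) = frechet_derivative (\<lambda>y. \<Gamma> y b a) (at x)" for a b
    by (rule frechet_derivative_cong_open[OF open_U x torsion_free])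
  from this[of v w] this[of u w] this[of u v] show ?thesis
    by (simp add: curv_def nabla_vec_def torsion_free[OF x, of v w] torsion_free[OF x, of u w] torsion_free[OF x, of u v])
qed

end

section \<open>Curvature in an adapted frame\<close>

lemma exhaust_5:
  fixes x :: 5
  shows "x = 1 \<or> x = 2 \<or> x = 3 \<or> x = 4 \<or> x = 5"
proof (induct x)
  case (of_int z)
  \<comment> \<open>In the type \<open>5\<close> the numeral 5 is 0, so the residue 0 is the case
    \<open>x = 5\<close>.\<close>
  then have "z = 0 \<or> z = 1 \<or> z = 2 \<or> z = 3 \<or> z = 4" by fastforce
  then show ?case by auto
qed

lemma UNIV_5: "UNIV = {1, 2, 3, 4, 5::5}"
  using exhaust_5 by auto

lemma distinct_5: "distinct [1, 2, 3, 4, 5::5]"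
  by simp

lemma sum_5: "sum f (UNIV::5 set) = f 1 + f 2 + f 3 + f 4 + f 5"
  unfolding UNIV_5 by (simp add: add_ac)

text \<open>A linear map from dimension 5 to dimension 3 is not injective.\<close>

lemma common_kernel_3:
  fixes f1 f2 f3 :: "real^5 \<Rightarrow> real"
  assumes "linear f1" "linear f2" "linear f3"
  shows "\<exists>z. z \<noteq> 0 \<and> f1 z = 0 \<and> f2 z = 0 \<and> f3 z = 0"
proof (rule ccontr)
  assume *: "\<not> ?thesis"
  let ?f = "\<lambda>z. (f1 z, f2 z, f3 z)"
  have lin: "linear ?f"
    using assms by (intro linearI) (simp_all add: linear_add linear_scale)
  then have "inj ?f" using * by (auto simp: linear_injective_0[OF lin] zero_prod_def)
  then have "dim (?f ` (UNIV :: (real^5) set)) = dim (UNIV :: (real^5) set)"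
    by (intro dim_image_eq lin) simp
  moreover have "dim (?f ` (UNIV :: (real^5) set)) \<le> DIM(real \<times> real \<times> real)"
    by (rule dim_subset_UNIV)
  ultimately show False by simp
qed

section \<open>Curvature symmetries of the connections\<close>

context sasaki_patch
begin

text \<open>By \<open>D_eq_LC_plus_T\<close> this is \<open>\<Gamma>\<close> plus the full torsion
  \<open>T\<close>, and its own torsion is twice \<open>T\<close>.\<close>

definition D' :: "real^'n \<Rightarrow> real^'n \<Rightarrow> real^'n \<Rightarrow> real^'n" where
  "D' y u v = D y u v + (1/2) *\<^sub>R T y u v"

lemma diff_T: "x \<in> U \<Longrightarrow> (\<lambda>y. T y u v) differentiable (at x)"
  using differentiableI[OF parallel_T] .

lemma T_cyclic: "x \<in> U \<Longrightarrow> G x (T x u v) w = G x (T x v w) u"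
  using T_skew[of x u v w] T_skew[of x v u w] T_antisym[of x v u]
  by (simp add: bilinear_lneg[OF bil_G])

text \<open>A totally skew torsion term drops out of the metric condition.\<close>

lemma metric_patch_D': "metric_patch U D' G"
proof
  show "open U" by (rule open_U)
next
  fix x assume x: "x \<in> U"
  show "bilinear (D' x)"
    using linear_C[OF x] bil_T[OF x] unfolding bilinear_def D'_def
    by (auto intro!: linear_compose_add linear_compose_scale_right)
  show "(\<lambda>y. D' y u v) differentiable (at x)" for u v
    unfolding D'_def using diff_C[OF x] diff_T[OF x]
    by (intro differentiable_add differentiable_scaleR) auto
  show "bilinear (G x)" by (rule bil_G[OF x])
  show "G x u v = G x v u" for u v by (rule sym_G[OF x])
  show "G x u u > 0" if "u \<noteq> 0" for u by (rule pos_G[OF x that])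
  show "(\<lambda>y. G y u v) differentiable (at x)" for u v by (rule diff_G[OF x])
  show "frechet_derivative (\<lambda>y. G y v w) (at x) u = G x (D' x u v) w + G x v (D' x u w)" for u v w
    using metric_C[OF x, of v w u] T_skew[OF x, of u v w] sym_G[OF x, of v "T x u w"]
    by (simp add: D'_def bilinear_ladd[OF bil_G[OF x]] bilinear_radd[OF bil_G[OF x]]
        bilinear_lmul[OF bil_G[OF x]] bilinear_rmul[OF bil_G[OF x]])
qed

definition RD where "RD x u v w z = G x (curv D x u v w) z"

definition RL where "RL x u v w z = G x (curv \<Gamma> x u v w) z"

text \<open>\<open>curv_add_parallel_torsion\<close> with \<open>a\<close> = -1/2; cyclicity of
  \<open>T\<close> rewrites nested torsions as inner products, which can be evaluated on a
  frame.\<close>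

lemma RL_eq:
  assumes x: "x \<in> U"
  shows "RL x u v w z = RD x u v w z - (1/2) * G x (T x u v) (T x w z)
     + (1/4) * (G x (T x z u) (T x v w) - G x (T x z v) (T x u w))"
proof -
  have "\<Gamma> y a b = D y a b + (- 1/2) *\<^sub>R T y a b" if "y \<in> U" for y a b
    using D_eq_LC_plus_T[OF that, of a b] by simp
  from curv_add_parallel_torsion[OF x this]
  have "curv \<Gamma> x u v w = curv D x u v w + (- 1/2) *\<^sub>R T x (T x u v) w
     + (1/4) *\<^sub>R (T x u (T x v w) - T x v (T x u w))" by simp
  moreover have "G x (T x (T x u v) w) z = G x (T x u v) (T x w z)"
    using T_cyclic[OF x, of "T x u v" w z] sym_G[OF x] by simp
  moreover have "G x (T x a b) z = G x (T x z a) b" for a b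
    by (rule T_cyclic[OF x, symmetric])
  ultimately show ?thesis
    by (simp add: RL_def RD_def bilinear_ladd[OF bil_G[OF x]] bilinear_lsub[OF bil_G[OF x]] bilinear_lmul[OF bil_G[OF x]])
qed

text \<open>The case \<open>a\<close> = 1/2: compared with \<open>RL_eq\<close>, only the linear
  term changes sign.\<close>

lemma RD'_eq:
  assumes x: "x \<in> U"
  shows "G x (curv D' x u v w) z = RD x u v w z + (1/2) * G x (T x u v) (T x w z)
     + (1/4) * (G x (T x z u) (T x v w) - G x (T x z v) (T x u w))"
proof -
  from curv_add_parallel_torsion[OF x D'_def]
  have "curv D' x u v w = curv D x u v w + (1/2) *\<^sub>R T x (T x u v) w
     + (1/4) *\<^sub>R (T x u (T x v w) - T x v (T x u w))" by simp
  moreover have "G x (T x (T x u v) w) z = G x (T x u v) (T x w z)"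
    using T_cyclic[OF x, of "T x u v" w z] sym_G[OF x] by simp
  moreover have "G x (T x a b) z = G x (T x z a) b" for a b
    by (rule T_cyclic[OF x, symmetric])
  ultimately show ?thesis
    by (simp add: RD_def bilinear_ladd[OF bil_G[OF x]] bilinear_lsub[OF bil_G[OF x]] bilinear_lmul[OF bil_G[OF x]])
qed

lemma RD_antisym1: "x \<in> U \<Longrightarrow> RD x v u w z = - RD x u v w z"
  by (simp add: RD_def curv_antisym[of x v u] bilinear_lneg[OF bil_G])

lemma RD_antisym2: "x \<in> U \<Longrightarrow> RD x u v z w = - RD x u v w z"
  using curv_skew[of x u v z w] sym_G[of x z] by (simp add: RD_def)

lemma RL_antisym1: "x \<in> U \<Longrightarrow> RL x v u w z = - RL x u v w z"
  by (simp add: RL_def LC.curv_antisym[of x v u] bilinear_lneg[OF bil_G])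

lemma RL_antisym2: "x \<in> U \<Longrightarrow> RL x u v z w = - RL x u v w z"
  using LC.curv_skew[of x u v z w] sym_G[of x z] by (simp add: RL_def)

lemma RL_bianchi: "x \<in> U \<Longrightarrow> RL x u v w z + RL x v w u z + RL x w u v z = 0"
  using arg_cong[OF bianchi_LC[of x u v w], of "\<lambda>a. G x a z"]
  by (simp add: RL_def bilinear_ladd[OF bil_G] bilinear_lzero[OF bil_G])

text \<open>The classical combination of four first Bianchi identities, one for each vector in the
  last slot, with the two skew symmetries.\<close>

lemma RL_pair_sym:
  assumes x: "x \<in> U"
  shows "RL x w z u v = RL x u v w z"
  using RL_bianchi[OF x, of u v w z] RL_bianchi[OF x, of v w z u]
    RL_bianchi[OF x, of w z u v] RL_bianchi[OF x, of z u v w]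
    RL_antisym1[OF x, of u w v z] RL_antisym2[OF x, of u w v z]
    RL_antisym1[OF x, of w u v z] RL_antisym2[OF x, of w u v z]
    RL_antisym1[OF x, of v z w u] RL_antisym2[OF x, of v z w u]
    RL_antisym1[OF x, of v w u z] RL_antisym2[OF x, of v w u z]
    RL_antisym1[OF x, of z u v w] RL_antisym2[OF x, of z u v w]
    RL_antisym1[OF x, of u v w z] RL_antisym2[OF x, of u v w z]
    RL_antisym1[OF x, of w z u v] RL_antisym2[OF x, of w z u v]
    RL_antisym1[OF x, of z v w u] RL_antisym2[OF x, of z v w u]
    RL_antisym1[OF x, of u z v w] RL_antisym2[OF x, of u z v w]
    RL_antisym1[OF x, of z u w v] RL_antisym2[OF x, of w v z u]
    RL_antisym2[OF x, of v w z u] RL_antisym1[OF x, of z w u v]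
  by linarith

text \<open>The torsion terms in \<open>RL_eq\<close> are invariant under exchange of the pairs, so
  the symmetry passes from \<open>RL\<close> to \<open>RD\<close>.\<close>

lemma RD_pair_sym:
  assumes x: "x \<in> U"
  shows "RD x w z u v = RD x u v w z"
proof -
  have "G x (T x v w) (T x z u) - G x (T x v z) (T x w u) = G x (T x z u) (T x v w) - G x (T x z v) (T x u w)"
    using T_antisym[of x v z] T_antisym[of x w u] sym_G[OF x, of "T x v w" "T x z u"]
      sym_G[OF x] by (simp add: bilinear_lneg[OF bil_G[OF x]] bilinear_rneg[OF bil_G[OF x]])
  then show ?thesis
    using RL_pair_sym[OF x, of w z u v] RL_eq[OF x, of u v w z] RL_eq[OF x, of w z u v]
      sym_G[OF x, of "T x u v" "T x w z"] by simp
qed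

text \<open>The first two equations hold because \<open>\<xi>\<close> is parallel; pair symmetry
  carries them over to the other pair of slots.\<close>

lemma RD_\<xi>:
  assumes x: "x \<in> U"
  shows "RD x u v (\<xi> x) z = 0" "RD x u v z (\<xi> x) = 0" "RD x (\<xi> x) u v z = 0" "RD x u (\<xi> x) v z = 0"
proof -
  show 1: "RD x u v (\<xi> x) z = 0" for u v z
    by (simp add: RD_def curv_D_\<xi>[OF x] bilinear_lzero[OF bil_G[OF x]])
  show 2: "RD x u v z (\<xi> x) = 0" for u v z
    using 1[of u v z] RD_antisym2[OF x, of u v z "\<xi> x"] by simp
  show "RD x (\<xi> x) u v z = 0" "RD x u (\<xi> x) v z = 0"
    using 1 2 RD_pair_sym[OF x] by metis+
qed

text \<open>\<open>\<phi>\<close> commutes with the curvature and is an isometry up to an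
  \<open>\<eta>\<close> term, which drops out because the curvature has no \<open>\<xi>\<close>
  component.\<close>

lemma RD_\<phi>:
  assumes x: "x \<in> U"
  shows "RD x u v (\<phi> x w) (\<phi> x z) = RD x u v w z"
  using RD_\<xi>(2)[OF x, of u v w]
  by (simp add: RD_def curv_D_\<phi>[OF x] G_\<phi>_\<phi>[OF x] G_\<xi>[OF x])

end

text \<open>Data at a single point: \<open>F_ba\<close> says that \<open>b\<close> is orthogonal to
  \<open>\<phi> p a\<close>, so \<open>a\<close>, \<open>b\<close> and their images under
  \<open>\<phi>\<close> form an orthonormal basis of the kernel of \<open>\<eta>\<close>.\<close>

locale adapted_frame = sasaki_patch U \<Gamma> D G \<xi> \<eta> \<phi>
  for U :: "(real^5) set" and \<Gamma> D G \<xi> \<eta> \<phi> +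
  fixes p a b :: "real^5"
  assumes p: "p \<in> U" and \<eta>_a: "\<eta> p a = 0" and \<eta>_b: "\<eta> p b = 0"
    and G_aa: "G p a a = 1" and G_bb: "G p b b = 1" and G_ab: "G p a b = 0" and F_ba: "F p b a = 0"
begin

text \<open>The signs are those for which \<open>d\<eta> = 2 (e\<^sub>1 \<and> e\<^sub>2 + e\<^sub>3 \<and> e\<^sub>4)\<close>.\<close>

definition e1 where "e1 = a"
definition e2 where "e2 = - \<phi> p a"
definition e3 where "e3 = b"
definition e4 where "e4 = - \<phi> p b"
definition e5 where "e5 = \<xi> p"

lemmas e_defs = e1_def e2_def e3_def e4_def e5_def

lemmas G_simps = bilinear_ladd[OF bil_G[OF p]] bilinear_radd[OF bil_G[OF p]] bilinear_lmul[OF bil_G[OF p]]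
    bilinear_rmul[OF bil_G[OF p]] bilinear_lsub[OF bil_G[OF p]] bilinear_rsub[OF bil_G[OF p]]
    bilinear_lneg[OF bil_G[OF p]] bilinear_rneg[OF bil_G[OF p]] bilinear_lzero[OF bil_G[OF p]] bilinear_rzero[OF bil_G[OF p]]

lemma \<eta>_e [simp]: "\<eta> p e1 = 0" "\<eta> p e2 = 0" "\<eta> p e3 = 0" "\<eta> p e4 = 0" "\<eta> p e5 = 1"
  by (simp_all add: e_defs \<eta>_a \<eta>_b \<eta>_\<phi>[OF p] \<eta>_\<xi>[OF p] linear_neg[OF lin_\<eta>[OF p]])

lemma \<phi>_e [simp]: "\<phi> p e1 = - e2" "\<phi> p e2 = e1" "\<phi> p e3 = - e4" "\<phi> p e4 = e3" "\<phi> p e5 = 0"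
  by (simp_all add: e_defs \<phi>_\<xi>[OF p] linear_neg[OF lin_\<phi>[OF p]] \<phi>_\<phi>[OF p] \<eta>_a \<eta>_b)

lemma G_e [simp]:
  "G p e1 e1 = 1" "G p e1 e2 = 0" "G p e1 e3 = 0" "G p e1 e4 = 0" "G p e1 e5 = 0"
  "G p e2 e1 = 0" "G p e2 e2 = 1" "G p e2 e3 = 0" "G p e2 e4 = 0" "G p e2 e5 = 0"
  "G p e3 e1 = 0" "G p e3 e2 = 0" "G p e3 e3 = 1" "G p e3 e4 = 0" "G p e3 e5 = 0"
  "G p e4 e1 = 0" "G p e4 e2 = 0" "G p e4 e3 = 0" "G p e4 e4 = 1" "G p e4 e5 = 0"
  "G p e5 e1 = 0" "G p e5 e2 = 0" "G p e5 e3 = 0" "G p e5 e4 = 0" "G p e5 e5 = 1"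
  using F_antisym[OF p, of a a] F_antisym[OF p, of b b] F_antisym[OF p, of b a]
    sym_G[OF p, of "\<phi> p a" a] sym_G[OF p, of "\<phi> p b" b] sym_G[OF p, of b a]
    sym_G[OF p, of "\<phi> p a" b] sym_G[OF p, of "\<phi> p b" a]
  by (simp_all add: e_defs G_simps G_aa G_bb G_ab F_ba G_\<phi>_\<phi>[OF p] \<eta>_a \<eta>_b G_\<xi>[OF p] \<eta>_\<phi>[OF p] \<eta>_\<xi>[OF p]
      linear_neg[OF lin_\<eta>[OF p]])

text \<open>The table of 2 (\<open>e1\<close> \<and> \<open>e2\<close> + \<open>e3\<close> \<and>
  \<open>e4\<close>) \<and> \<open>e5\<close> with one slot raised.\<close>

lemma T_e [simp]:
  "T p e1 e1 = 0" "T p e1 e2 = 2 *\<^sub>R e5" "T p e1 e3 = 0" "T p e1 e4 = 0" "T p e1 e5 = - 2 *\<^sub>R e2"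
  "T p e2 e1 = - 2 *\<^sub>R e5" "T p e2 e2 = 0" "T p e2 e3 = 0" "T p e2 e4 = 0" "T p e2 e5 = 2 *\<^sub>R e1"
  "T p e3 e1 = 0" "T p e3 e2 = 0" "T p e3 e3 = 0" "T p e3 e4 = 2 *\<^sub>R e5" "T p e3 e5 = - 2 *\<^sub>R e4"
  "T p e4 e1 = 0" "T p e4 e2 = 0" "T p e4 e3 = - 2 *\<^sub>R e5" "T p e4 e4 = 0" "T p e4 e5 = 2 *\<^sub>R e3"
  "T p e5 e1 = 2 *\<^sub>R e2" "T p e5 e2 = - 2 *\<^sub>R e1" "T p e5 e3 = 2 *\<^sub>R e4" "T p e5 e4 = - 2 *\<^sub>R e3" "T p e5 e5 = 0"
  by (simp_all add: T_eq[OF p] G_simps flip: e5_def)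

definition e :: "5 \<Rightarrow> real^5" where
  "e i = (if i = 1 then e1 else if i = 2 then e2 else if i = 3 then e3 else if i = 4 then e4 else e5)"

lemma e_numeral [simp]: "e 1 = e1" "e 2 = e2" "e 3 = e3" "e 4 = e4" "e 5 = e5"
  using distinct_5 by (auto simp: e_def)

lemma orth_e: "G p (e i) (e j) = (if i = j then 1 else 0)"
  using exhaust_5[of i] exhaust_5[of j] distinct_5 by auto

lemma RD_\<xi>_e [simp]: "RD p u v e5 z = 0" "RD p u v z e5 = 0" "RD p e5 u v z = 0" "RD p u e5 v z = 0"
  unfolding e5_def by (rule RD_\<xi>[OF p])+

lemma RD_zero [simp]: "RD p u v w w = 0" "RD p u u v w = 0"
  using RD_antisym2[OF p, of u v w w] RD_antisym1[OF p, of u u v w] by simp_all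

lemma ricci_trace:
  "(\<Sum>i\<in>UNIV. curv \<Gamma> p (axis i 1) v w $ i)
    = RL p e1 v w e1 + RL p e2 v w e2 + RL p e3 v w e3 + RL p e4 v w e4 + RL p e5 v w e5"
  unfolding trace_orthonormal[OF bil_G[OF p] orth_e LC.linear_curv(1)[OF p]] sum_5
  by (simp add: RL_def)

lemma RD_neg [simp]: "RD p u v (- w) z = - RD p u v w z" "RD p u v w (- z) = - RD p u v w z"
  by (simp_all add: RD_def linear_neg[OF linear_curv(3)[OF p]] G_simps)

text \<open>The first two equations express that the curvature operator of (\<open>e3\<close>,
  \<open>e4\<close>) commutes with \<open>\<phi>\<close>. The third combines the Einstein equation
  in direction \<open>e3\<close> with the Bianchi identity of \<open>\<Gamma>\<close>, both carried
  over to \<open>D\<close> by \<open>RL_eq\<close>.\<close>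

lemma RD_e34:
  assumes ric: "(\<Sum>i\<in>UNIV. curv \<Gamma> p (axis i 1) e3 e3 $ i) = 4"
  shows "RD p e3 e4 e2 e4 = RD p e3 e4 e1 e3" "RD p e3 e4 e2 e3 = - RD p e3 e4 e1 e4"
    and "RD p e3 e4 e1 e2 + RD p e3 e4 e3 e4 = 2"
proof -
  show "RD p e3 e4 e2 e4 = RD p e3 e4 e1 e3" "RD p e3 e4 e2 e3 = - RD p e3 e4 e1 e4"
    using RD_\<phi>[OF p, of e3 e4 e1 e3] RD_\<phi>[OF p, of e3 e4 e1 e4] by simp_all
  \<comment> \<open>Each summand of the Ricci trace gains a quarter of the squared length of
    \<open>T p (e i) e3\<close>, which is 1 for \<open>e4\<close> and for \<open>e5\<close> and 0
    otherwise; so 4 becomes 2.\<close>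
  have tr: "RD p e1 e3 e3 e1 + RD p e2 e3 e3 e2 + RD p e4 e3 e3 e4 = 2"
    using ric unfolding ricci_trace RL_eq[OF p] by (simp add: G_simps)
  \<comment> \<open>The torsion contributes -2, -1 and -1 to the three terms of the cyclic
    sum.\<close>
  have bi: "RD p e3 e4 e1 e2 + RD p e4 e1 e3 e2 + RD p e1 e3 e4 e2 = 4"
    using RL_bianchi[OF p, of e3 e4 e1 e2] unfolding RL_eq[OF p] by (simp add: G_simps)
  \<comment> \<open>Invariance under \<open>\<phi>\<close> turns the mixed curvatures of
    \<open>bi\<close> into those of \<open>tr\<close>.\<close>
  have "RD p e4 e1 e3 e2 = RD p e2 e3 e3 e2"
    using RD_\<phi>[OF p, of e3 e2 e4 e1] RD_pair_sym[OF p, of e4 e1 e3 e2] RD_pair_sym[OF p, of e2 e3 e3 e2]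
      RD_antisym1[OF p, of e2 e3 e3 e2]  RD_antisym2[OF p, of e3 e2 e3 e2] by simp
  moreover have "RD p e1 e3 e4 e2 = RD p e1 e3 e3 e1"
    using RD_\<phi>[OF p, of e1 e3 e4 e2] by simp
  ultimately show "RD p e3 e4 e1 e2 + RD p e3 e4 e3 e4 = 2"
    using tr bi RD_antisym1[OF p, of e3 e4 e3 e4] by simp
qed

text \<open>Hypothesis \<open>K\<close> holds for multiplication by a complex number, which is
  injective or zero; the zero case is settled by the same equations.\<close>

theorem killing_vanishes:
  assumes kp: "killing_patch U D' G P E K \<psi>"
    and ric: "(\<Sum>i\<in>UNIV. curv \<Gamma> p (axis i 1) e3 e3 $ i) = 4"
    and K: "\<And>z. K z = 0 \<Longrightarrow> z = 0 \<or> (\<forall>w. K w = 0)"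
  shows "\<psi> p = 0"
proof -
  interpret KP: killing_patch U D' G P E K \<psi> by (rule kp)
  \<comment> \<open>Clifford multiplication by an arbitrary tangent vector at \<open>p\<close>,
    expressed through the frame \<open>E\<close> in which the Killing equation is given.\<close>
  define c where "c v w = KP.cvec (\<lambda>i. G p v (E p i)) w" for v w
  have c_lin: "linear (c v)" for v unfolding c_def by (rule KP.linear_cvec)
  note c_simps = linear_add[OF c_lin] linear_diff[OF c_lin] linear_neg[OF c_lin] linear_scale[OF c_lin] linear_0[OF c_lin]
  have c_scale: "c (r *\<^sub>R v) w = r *\<^sub>R c v w" for r v w
    unfolding c_def KP.cvec_scale[symmetric] by (simp add: G_simps)
  have c_minus: "c (- v) w = - c v w" for v w
    using c_scale[of "-1" v w] by simp
  have anti: "c u (c v w) + c v (c u w) = (- 2 * G p u v) *\<^sub>R w" for u v w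
    unfolding c_def KP.cvec_anticommute KP.expand_G[OF p, of u v] ..
  have sq: "c v (c v w) = - w" if "G p v v = 1" for v w
  proof -
    have "2 *\<^sub>R c v (c v w) = 2 *\<^sub>R (- w)" using anti[of v v w] that by (simp add: scaleR_2)
    then show ?thesis by (simp del: scaleR_minus_right)
  qed
  have swap: "c v (c u w) = - c u (c v w)" if "G p u v = 0" for u v w
    using anti[of u v w] that by (simp add: eq_neg_iff_add_eq_0 add.commute)
  note cl = sq[of e1] sq[of e2] sq[of e3] sq[of e4] sq[of e5]
    swap[of e1 e2] swap[of e1 e3] swap[of e1 e4] swap[of e1 e5] swap[of e2 e3] swap[of e2 e4]
    swap[of e2 e5] swap[of e3 e4] swap[of e3 e5] swap[of e4 e5]
  \<comment> \<open>Contracting over \<open>E\<close> or over the adapted frame gives the same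
    result, as both are orthonormal; \<open>quad\<close> does this in two indices.\<close>
  have rebase: "(\<Sum>i\<in>UNIV. l (E p i) *\<^sub>R V i) = (\<Sum>k\<in>UNIV. l (e k) *\<^sub>R (\<Sum>i\<in>UNIV. G p (e k) (E p i) *\<^sub>R V i))"
    if l: "linear l" for l :: "real^5 \<Rightarrow> real" and V :: "5 \<Rightarrow> 'a"
  proof -
    have "l (E p i) = (\<Sum>k\<in>UNIV. G p (e k) (E p i) * l (e k))" for i
    proof -
      have "l (E p i) = l (\<Sum>k\<in>UNIV. G p (E p i) (e k) *\<^sub>R e k)"
        using orthonormal_expansion[OF bil_G[OF p] orth_e, of "E p i"] by simp
      then show ?thesis
        by (simp add: linear_sum[OF l] linear_scale[OF l] sym_G[OF p, of "E p i"])
    qed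
    then have "(\<Sum>i\<in>UNIV. l (E p i) *\<^sub>R V i) = (\<Sum>i\<in>UNIV. \<Sum>k\<in>UNIV. (G p (e k) (E p i) * l (e k)) *\<^sub>R V i)"
      by (simp add: scaleR_sum_left)
    also have "\<dots> = (\<Sum>k\<in>UNIV. l (e k) *\<^sub>R (\<Sum>i\<in>UNIV. G p (e k) (E p i) *\<^sub>R V i))"
      by (subst sum.swap) (simp add: scaleR_sum_right mult.commute)
    finally show ?thesis .
  qed
  have quad: "KP.cquad (\<lambda>i j. \<beta> (E p i) (E p j)) w
      = (\<Sum>k\<in>UNIV. \<Sum>l\<in>UNIV. \<beta> (e k) (e l) *\<^sub>R c (e k) (c (e l) w))"
    if bil: "bilinear \<beta>" for \<beta> w
  proof -
    have l1: "linear (\<beta> z)" and l2: "linear (\<lambda>z. \<beta> z z')" for z z'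
      using bil by (simp_all add: bilinear_def)
    have "KP.cquad (\<lambda>i j. \<beta> (E p i) (E p j)) w
        = (\<Sum>i\<in>UNIV. P i (\<Sum>j\<in>UNIV. \<beta> (E p i) (E p j) *\<^sub>R P j w))"
      by (simp add: KP.cquad_def KP.P_sum KP.P_scaleR)
    also have "\<dots> = (\<Sum>i\<in>UNIV. \<Sum>l\<in>UNIV. \<beta> (E p i) (e l) *\<^sub>R P i (c (e l) w))"
      unfolding rebase[OF l1] by (simp add: KP.P_sum KP.P_scaleR c_def KP.cvec_def)
    also have "\<dots> = (\<Sum>l\<in>UNIV. \<Sum>i\<in>UNIV. \<beta> (E p i) (e l) *\<^sub>R P i (c (e l) w))"
      by (rule sum.swap)
    also have "\<dots> = (\<Sum>l\<in>UNIV. \<Sum>k\<in>UNIV. \<beta> (e k) (e l) *\<^sub>R c (e k) (c (e l) w))"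
      unfolding rebase[OF l2] by (simp add: c_def KP.cvec_def)
    also have "\<dots> = (\<Sum>k\<in>UNIV. \<Sum>l\<in>UNIV. \<beta> (e k) (e l) *\<^sub>R c (e k) (c (e l) w))"
      by (rule sum.swap)
    finally show ?thesis .
  qed
  have bilR: "bilinear (\<lambda>w z. G p (curv D' p u v w) z)" for u v
  proof -
    have "linear (\<lambda>w. G p w z)" "linear (G p w)" for w z
      using bil_G[OF p] by (simp_all add: bilinear_def)
    then show ?thesis
      unfolding bilinear_def
      using linear_compose[OF KP.linear_curv(3)[OF p], of "\<lambda>w. G p w _", unfolded o_def] by blast
  qed
  \<comment> \<open>The factor 2 before the torsion comes from \<open>D'\<close>, whose torsion is
    twice \<open>T\<close>.\<close>
  have integrability: "(1/4) *\<^sub>R (\<Sum>k\<in>UNIV. \<Sum>l\<in>UNIV. G p (curv D' p u v (e k)) (e l) *\<^sub>R c (e k) (c (e l) (\<psi> p)))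
      = 2 *\<^sub>R K (c (T p u v) (\<psi> p)) + K (K (c v (c u (\<psi> p)) - c u (c v (\<psi> p))))" for u v
  proof -
    have "D' p u v - D' p v u = 2 *\<^sub>R T p u v"
      by (simp add: D'_def T_antisym[of p v u] T_def[of p u v, symmetric] add_diff_eq[symmetric])
         (simp add: T_def scaleR_2 algebra_simps)
    then show ?thesis
      using KP.killing_integrability[OF p, of u v] unfolding quad[OF bilR] c_def[symmetric]
      by (simp add: c_scale linear_scale[OF KP.linear_K])
  qed
  have Kc: "K (c v w) = c v (K w)" for v w
    unfolding c_def by (rule KP.K_cvec)
  note K_simps = linear_add[OF KP.linear_K] linear_diff[OF KP.linear_K] linear_neg[OF KP.linear_K] linear_scale[OF KP.linear_K] Kc
  define s where "s = \<psi> p"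
  note eval = sum_5 RD'_eq[OF p] G_simps cl K_simps c_scale c_minus c_simps scaleR_add_right scaleR_diff_right
  \<comment> \<open>The pair (\<open>e5\<close>, \<open>e1\<close>); \<open>raw3\<close> is the pair
    (\<open>e5\<close>, \<open>e3\<close>). Inner products with basis vectors reduce the comparison
    to real arithmetic.\<close>
  have raw1: "4 *\<^sub>R c e2 (K s) + 2 *\<^sub>R c e1 (c e5 (K (K s))) + (3/2) *\<^sub>R c e1 (c e5 s) = 0"
  proof (rule euclidean_eqI)
    fix b :: 'a
    show "(4 *\<^sub>R c e2 (K s) + 2 *\<^sub>R c e1 (c e5 (K (K s))) + (3/2) *\<^sub>R c e1 (c e5 s)) \<bullet> b = 0 \<bullet> b"
      using arg_cong[OF integrability[of e5 e1, folded s_def], of "\<lambda>z. z \<bullet> b"]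
      by (simp add: eval inner_add_left inner_diff_left)
  qed
  have raw3: "4 *\<^sub>R c e4 (K s) + 2 *\<^sub>R c e3 (c e5 (K (K s))) + (3/2) *\<^sub>R c e3 (c e5 s) = 0"
  proof (rule euclidean_eqI)
    fix b :: 'a
    show "(4 *\<^sub>R c e4 (K s) + 2 *\<^sub>R c e3 (c e5 (K (K s))) + (3/2) *\<^sub>R c e3 (c e5 s)) \<bullet> b = 0 \<bullet> b"
      using arg_cong[OF integrability[of e5 e3, folded s_def], of "\<lambda>z. z \<bullet> b"]
      by (simp add: eval inner_add_left inner_diff_left)
  qed
  have A1: "4 *\<^sub>R c e1 (c e2 (K s)) = 2 *\<^sub>R c e5 (K (K s)) + (3/2) *\<^sub>R c e5 s"
    using arg_cong[OF raw1, of "c e1"] by (simp add: c_simps cl algebra_simps)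
  have A3: "4 *\<^sub>R c e3 (c e4 (K s)) = 2 *\<^sub>R c e5 (K (K s)) + (3/2) *\<^sub>R c e5 s"
    using arg_cong[OF raw3, of "c e3"] by (simp add: c_simps cl algebra_simps)
  \<comment> \<open>This eliminates \<open>K\<close> from \<open>B\<close>, whose right-hand side
    becomes (3/2) \<open>c e3 (c e4 s)\<close>.\<close>
  have A5: "4 *\<^sub>R c e5 (K s) = 2 *\<^sub>R c e3 (c e4 (K (K s))) + (3/2) *\<^sub>R c e3 (c e4 s)"
    using arg_cong[OF A3, of "\<lambda>z. - c e3 (c e4 (c e5 z))"] by (simp add: c_simps cl)
  \<comment> \<open>The pair (\<open>e3\<close>, \<open>e4\<close>). By \<open>RD_e34\<close> the
    mixed curvature terms group into multiples of two vectors that vanish once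
    \<open>c e1 (c e2 s)\<close> equals \<open>c e3 (c e4 s)\<close>.\<close>
  have B: "c e1 (c e2 s) + (3/2) *\<^sub>R c e3 (c e4 s) + (1/2) *\<^sub>R (RD p e3 e4 e1 e2 *\<^sub>R c e1 (c e2 s)
      + RD p e3 e4 e3 e4 *\<^sub>R c e3 (c e4 s) + RD p e3 e4 e1 e3 *\<^sub>R (c e1 (c e3 s) + c e2 (c e4 s))
      + RD p e3 e4 e1 e4 *\<^sub>R (c e1 (c e4 s) - c e2 (c e3 s)))
    = 4 *\<^sub>R c e5 (K s) - 2 *\<^sub>R c e3 (c e4 (K (K s)))" (is "?L = ?R")
  proof (rule euclidean_eqI)
    fix b :: 'a
    show "?L \<bullet> b = ?R \<bullet> b"
      using arg_cong[OF integrability[of e3 e4, folded s_def], of "\<lambda>z. z \<bullet> b"] RD_e34(1,2)[OF ric]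
      by (simp add: eval inner_add_left inner_diff_left RD_antisym2[OF p, of e3 e4 e2 e1]
        RD_antisym2[OF p, of e3 e4 e3 e1] RD_antisym2[OF p, of e3 e4 e4 e1] RD_antisym2[OF p, of e3 e4 e3 e2]
        RD_antisym2[OF p, of e3 e4 e4 e2] RD_antisym2[OF p, of e3 e4 e4 e3] algebra_simps)
  qed
  have "K (c e1 (c e2 s) - c e3 (c e4 s)) = 0"
  proof -
    have "4 *\<^sub>R c e1 (c e2 (K s)) = 4 *\<^sub>R c e3 (c e4 (K s))" by (simp only: A1 A3)
    then show ?thesis by (simp add: K_simps)
  qed
  from K[OF this] have "c e1 (c e2 s) - c e3 (c e4 s) = 0 \<or> s = 0"
  proof
    \<comment> \<open>Here \<open>A1\<close> reduces to (3/2) \<open>c e5 s\<close> = 0.\<close>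
    assume "\<forall>w. K w = 0"
    then have "c e5 (c e5 s) = 0" using A1 by (simp add: c_simps)
    then show ?thesis by (simp add: cl)
  qed simp
  then show ?thesis
  proof
    assume "c e1 (c e2 s) - c e3 (c e4 s) = 0"
    then have x: "c e1 (c e2 s) = c e3 (c e4 s)" by simp
    have "- c e2 (c e4 s) = c e1 (c e3 s)"
      using arg_cong[OF x, of "\<lambda>z. c e1 (c e4 z)"] by (simp add: c_simps cl)
    then have "c e1 (c e3 s) + c e2 (c e4 s) = 0"
      by (metis add.left_inverse)
    moreover have "c e1 (c e4 s) - c e2 (c e3 s) = 0"
      using arg_cong[OF x, of "\<lambda>z. c e1 (c e3 z)"] by (simp add: c_simps cl)
    \<comment> \<open>Every term is now a multiple of \<open>c e3 (c e4 s)\<close>: the coefficients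
      are 1 + 3/2 + 1 on the left, since the curvature sum is 2, and 3/2 on the right.\<close>
    ultimately have "c e3 (c e4 s) + (3/2) *\<^sub>R c e3 (c e4 s)
        + (1/2) *\<^sub>R ((RD p e3 e4 e1 e2 + RD p e3 e4 e3 e4) *\<^sub>R c e3 (c e4 s)) = (3/2) *\<^sub>R c e3 (c e4 s)"
      using B unfolding A5 x by (simp add: scaleR_add_left)
    then have "2 *\<^sub>R c e3 (c e4 s) = 0"
      unfolding RD_e34(3)[OF ric] by (simp add: scaleR_2)
    then have "c e4 (c e3 (c e3 (c e4 s))) = 0" by (simp add: c_simps)
    then show ?thesis by (simp add: cl c_simps s_def)
  qed (simp add: s_def)
qed

end

section \<open>From charts to the manifold\<close>

text \<open>Any unit \<open>a\<close> in the kernel of \<open>\<eta>\<close> will do;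
  \<open>b\<close> is then a unit vector there orthogonal to \<open>a\<close> and
  \<open>\<phi> p a\<close>, which makes three linear conditions in dimension 5.\<close>

lemma adapted_frame_exists:
  fixes U :: "(real^5) set"
  assumes "sasaki_patch U \<Gamma> D G \<xi> \<eta> \<phi>" and p: "p \<in> U"
  shows "\<exists>a b. adapted_frame U \<Gamma> D G \<xi> \<eta> \<phi> p a b"
proof -
  interpret sasaki_patch U \<Gamma> D G \<xi> \<eta> \<phi> by (rule assms(1))
  have lin1: "linear (\<lambda>z. G p z w)" and lin2: "linear (G p w)" for w
    using bil_G[OF p] by (simp_all add: bilinear_def)
  have normalize: "G p (inverse (sqrt (G p z z)) *\<^sub>R z) (inverse (sqrt (G p z z)) *\<^sub>R z) = 1" if "z \<noteq> 0" for z
    using pos_G[OF p that] by (simp add: linear_scale[OF lin1] linear_scale[OF lin2] field_simps)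
  \<comment> \<open>There is a single condition here, so the same functional is passed three
    times.\<close>
  obtain y where y: "y \<noteq> 0" "\<eta> p y = 0"
    using common_kernel_3[OF lin_\<eta>[OF p] lin_\<eta>[OF p] lin_\<eta>[OF p]] by blast
  define a where "a = inverse (sqrt (G p y y)) *\<^sub>R y"
  obtain z where z: "z \<noteq> 0" "\<eta> p z = 0" "G p z a = 0" "G p z (\<phi> p a) = 0"
    using common_kernel_3[OF lin_\<eta>[OF p] lin1[of a] lin1[of "\<phi> p a"]] by blast
  define b where "b = inverse (sqrt (G p z z)) *\<^sub>R z"
  have "adapted_frame U \<Gamma> D G \<xi> \<eta> \<phi> p a b"
  proof
    show "p \<in> U" by (rule p)
    show "\<eta> p a = 0" "\<eta> p b = 0"
      using y z by (simp_all add: a_def b_def linear_scale[OF lin_\<eta>[OF p]])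
    show "G p a a = 1" "G p b b = 1"
      unfolding a_def b_def by (rule normalize, fact)+
    show "G p a b = 0" "G p b (\<phi> p a) = 0"
      using z sym_G[OF p, of a z] by (simp_all add: b_def linear_scale[OF lin1] linear_scale[OF lin2])
  qed
  then show ?thesis by blast
qed

section \<open>Instantiating the local results in a chart\<close>

lemma smooth_on_differentiable: "smooth_on S f \<Longrightarrow> x \<in> S \<Longrightarrow> f differentiable (at x)"
  unfolding smooth_on_def by (metis Ck_on.simps(2))

lemma smooth_on_differentiable2:
  "smooth_on S f \<Longrightarrow> x \<in> S \<Longrightarrow> (\<lambda>y. frechet_derivative f (at y) v) differentiable (at x)"
  unfolding smooth_on_def by (metis Ck_on.simps(2))

lemma linear_matrix_action: "linear (\<lambda>M :: complex^'m^'n. M *v w)"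
  by (rule linearI)
     (simp_all add: vec_eq_iff matrix_vector_mult_def algebra_simps sum.distrib scaleR_sum_right)

lemma linear_matrix_vector: "linear (\<lambda>w. (M :: complex^'m^'n) *v w)"
  by (rule linearI)
     (simp_all add: vec_eq_iff matrix_vector_mult_def algebra_simps sum.distrib scaleR_sum_right)

lemma linear_complex_scale: "linear (\<lambda>w :: complex^'m. \<kappa> *s w)"
  by (rule linearI) (simp_all add: vec_eq_iff algebra_simps)

lemma matrix_complex_scale: "(M :: complex^'m^'n) *v (\<kappa> *s w) = \<kappa> *s (M *v w)"
  by (simp add: vec_eq_iff matrix_vector_mult_def sum_distrib_left mult.left_commute)

lemma spinor_module_clifford:
  fixes \<gamma> :: "'n::finite \<Rightarrow> complex^'s^'s::finite"
  assumes "spinor_module \<gamma>"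
  shows "clifford_module (\<lambda>i w. \<gamma> i *v w)"
proof (rule clifford_module.intro)
  show "linear (\<lambda>w. \<gamma> i *v w)" for i by (rule linear_matrix_vector)
  have "(mat (-2) :: complex^'s^'s) *v w = -2 *\<^sub>R w" for w
    by (simp add: vec_eq_iff matrix_vector_mult_def mat_def if_distrib[of "\<lambda>z. z * _"] scaleR_conv_of_real cong: if_cong)
  moreover have "\<gamma> i *v (\<gamma> j *v w) + \<gamma> j *v (\<gamma> i *v w) = (\<gamma> i ** \<gamma> j + \<gamma> j ** \<gamma> i) *v w" for i j w
    by (simp add: matrix_vector_mul_assoc linear_add[OF linear_matrix_action])
  ultimately show "\<gamma> i *v (\<gamma> j *v w) + \<gamma> j *v (\<gamma> i *v w) = (if i = j then - 2 *\<^sub>R w else 0)" for i j w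
    using assms by (simp add: spinor_module_def linear_0[OF linear_matrix_action])
qed

lemma metric_patch_chart:
  assumes at: "smooth_atlas A" and g: "riemannian_metric A g" and D: "metric_connection A g D" and c: "c \<in> A"
  shows "metric_patch (coords c) (D c) (g c)"
proof (intro metric_patch.intro connection_patch.intro metric_patch_axioms.intro)
  show "open (coords c)" using at c by (simp add: smooth_atlas_def)
next
  fix x assume x: "x \<in> coords c"
  note defs = riemannian_metric_def metric_connection_def affine_connection_def
  show "bilinear (D c x)" "bilinear (g c x)"
    using g D c x by (simp_all add: defs)
  show "(\<lambda>y. D c y u v) differentiable (at x)" "(\<lambda>y. g c y u v) differentiable (at x)" for u v
    using g D c by (auto simp: defs intro!: smooth_on_differentiable[OF _ x])
  show "g c x u v = g c x v u" for u v using g c x by (simp add: defs)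
  show "g c x u u > 0" if "u \<noteq> 0" for u using g c x that by (simp add: defs)
  show "frechet_derivative (\<lambda>y. g c y v w) (at x) u = g c x (D c x u v) w + g c x v (D c x u w)" for u v w
    using D c x by (simp add: defs)
qed

lemma sasaki_patch_chart:
  assumes at: "smooth_atlas A" and sas: "sasakian A g \<xi> \<eta> \<phi>" and lc: "levi_civita A g LC"
    and ch: "characteristic_connection A g \<xi> \<eta> \<phi> D" and c: "c \<in> A"
  shows "sasaki_patch (coords c) (LC c) (D c) (g c) (\<xi> c) (\<eta> c) (\<phi> c)"
proof (intro sasaki_patch.intro sasaki_patch_axioms.intro)
  show "metric_patch (coords c) (LC c) (g c)" "metric_patch (coords c) (D c) (g c)"
    using metric_patch_chart[OF at _ _ c] sas lc ch
    by (simp_all add: sasakian_def levi_civita_def characteristic_connection_def)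
next
  fix x assume x: "x \<in> coords c"
  note defs = sasakian_def vector_field_def one_form_def endo_field_def
  show "linear (\<eta> c x)" "linear (\<phi> c x)"
    using sas c x by (simp_all add: defs)
  show "(\<lambda>y. \<eta> c y u) differentiable (at x)"
    "(\<lambda>y. \<phi> c y u) differentiable (at x)" "\<xi> c differentiable (at x)" for u
    using sas c by (auto simp: defs intro!: smooth_on_differentiable[OF _ x])
  show "LC c x u v = LC c x v u" for u v
    using lc c x by (simp add: levi_civita_def torsion_def)
  show "g c x (D c x u w - D c x w u) v = - g c x (D c x u v - D c x v u) w" for u v w
    using ch c x unfolding characteristic_connection_def skew_torsion_def torsion_form_def torsion_def by blast
  show "\<eta> c x (\<xi> c x) = 1" "\<phi> c x (\<phi> c x u) = - u + \<eta> c x u *\<^sub>R \<xi> c x"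
    "g c x (\<phi> c x u) (\<phi> c x v) = g c x u v - \<eta> c x u * \<eta> c x v"
    "ext_deriv (\<eta> c) x u v = 2 * g c x u (\<phi> c x v)" for u v
    using sas c x by (simp_all add: sasakian_def)
  show "nabla_vec (D c) (\<xi> c) x u = 0" "nabla_form (D c) (\<eta> c) x u v = 0"
    "nabla_endo (D c) (\<phi> c) x u v = 0" for u v
    using ch c x by (simp_all add: characteristic_connection_def)
qed

text \<open>It suffices to show \<open>\<psi> c p = 0\<close> in an arbitrary chart at an arbitrary
  point, where the components in that chart instantiate \<open>adapted_frame\<close> and
  \<open>killing_patch\<close>.\<close>

theorem corollaryA1:
  fixes A :: "('m::{t2_space, second_countable_topology}, 5) chart set"
    and g :: "('m, 5) form2"
    and \<xi> :: "('m, 5) vfield"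
    and \<eta> :: "('m, 5) form1"
    and \<phi> :: "('m, 5) endo"
    and LC D :: "('m, 5) connection"
    and \<gamma> :: "5 \<Rightarrow> complex^4^4"
    and E :: "('m, 5) frame"
    and S :: "('m, 5) chart \<Rightarrow> ('m, 5) chart \<Rightarrow> real^5 \<Rightarrow> complex^4^4"
  assumes "smooth_atlas A"
    and "sasakian A g \<xi> \<eta> \<phi>"
    and "levi_civita A g LC"
    and "einstein_metric A g LC 4"
    and "spinor_module \<gamma>"
    and "spin_structure A g \<gamma> E S"
    and "characteristic_connection A g \<xi> \<eta> \<phi> D"
  shows "\<not> (\<exists>\<psi>. killing_spinor_with_torsion A g LC D \<gamma> E S \<psi> \<and>
               (\<exists>c\<in>A. \<exists>x\<in>coords c. \<psi> c x \<noteq> 0))"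
proof -
  have "\<psi> c p = 0" if ks: "killing_spinor_with_torsion A g LC D \<gamma> E S \<psi>" and c: "c \<in> A" and p: "p \<in> coords c"
    for \<psi> c p
  proof -
    have sp: "sasaki_patch (coords c) (LC c) (D c) (g c) (\<xi> c) (\<eta> c) (\<phi> c)"
      by (rule sasaki_patch_chart[OF assms(1-3,7) c])
    obtain a b where "adapted_frame (coords c) (LC c) (D c) (g c) (\<xi> c) (\<eta> c) (\<phi> c) p a b"
      using adapted_frame_exists[OF sp p] by blast
    then interpret adapted_frame "coords c" "LC c" "D c" "g c" "\<xi> c" "\<eta> c" "\<phi> c" p a b .
    interpret CM: clifford_module "\<lambda>i w. \<gamma> i *v w"
      by (rule spinor_module_clifford[OF assms(5)])
    \<comment> \<open>For n = 5 the parameter (n - 1) / (4 (n - 3)) is 1/2.\<close>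
    obtain \<kappa> where kill: "\<And>x u. x \<in> coords c \<Longrightarrow>
        spin_nabla_torsion (1/2) g LC D \<gamma> E \<psi> c x u = \<kappa> *s (cliff \<gamma> (\<chi> i. g c x u (E c x i)) *v \<psi> c x)"
      using ks c by (auto simp: killing_spinor_with_torsion_def)
    have quad: "(\<Sum>i\<in>UNIV. \<Sum>j\<in>UNIV. W i j *\<^sub>R (\<gamma> i ** \<gamma> j)) *v w = CM.cquad W w" for W w
      by (simp add: CM.cquad_def linear_sum[OF linear_matrix_action] linear_scale[OF linear_matrix_action]
          matrix_vector_mul_assoc)
    have vec: "cliff \<gamma> (\<chi> i. v i) *v w = CM.cvec v w" for v w
      by (simp add: CM.cvec_def cliff_def linear_sum[OF linear_matrix_action] linear_scale[OF linear_matrix_action])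
    have E: "smooth_on (coords c) (\<lambda>x. E c x i)" for i
      using assms(6) c by (simp add: spin_structure_def)
    have \<psi>: "smooth_on (coords c) (\<psi> c)"
      using ks c by (simp add: killing_spinor_with_torsion_def spinor_field_def)
    have kp: "killing_patch (coords c) D' (g c) (\<lambda>i w. \<gamma> i *v w) (E c) (\<lambda>w. \<kappa> *s w) (\<psi> c)"
    proof (intro killing_patch.intro killing_patch_axioms.intro metric_patch_D' CM.clifford_module_axioms)
      fix x assume x: "x \<in> coords c"
      show "g c x (E c x i) (E c x j) = (if i = j then 1 else 0)" for i j
        using assms(6) c x by (simp add: spin_structure_def)
      show "(\<lambda>y. E c y i) differentiable (at x)" for i
        by (rule smooth_on_differentiable[OF E x])
      show "(\<lambda>y. frechet_derivative (\<lambda>z. E c z i) (at y) v) differentiable (at x)" for i v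
        by (rule smooth_on_differentiable2[OF E x])
      show "\<psi> c differentiable (at x)"
        by (rule smooth_on_differentiable[OF \<psi> x])
      have D'_LC: "D' x v w = LC c x v w + T x v w" for v w
        by (simp add: D'_def D_eq_LC_plus_T[OF x, of v w] flip: scaleR_add_left)
      \<comment> \<open>The parameter 1/2 times the factor 1/2 in \<open>cliff2\<close> is the
        coefficient 1/4 of the spin connection, so the torsion term is absorbed into the connection
        matrix of \<open>D'\<close>.\<close>
      have N: "g c x (nabla_vec D' (\<lambda>y. E c y i) x v) (E c x j)
          = g c x (nabla_vec (LC c) (\<lambda>y. E c y i) x v) (E c x j) + torsion_form g D c x v (E c x i) (E c x j)" for v i j
        using bilinear_ladd[OF bil_G[OF x]]
        by (simp add: nabla_vec_def D'_LC torsion_form_def torsion_def T_def flip: add.assoc)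
      show "frechet_derivative (\<psi> c) (at x) v =
        - ((1/4) *\<^sub>R CM.cquad (\<lambda>i j. g c x (nabla_vec D' (\<lambda>y. E c y i) x v) (E c x j)) (\<psi> c x))
        + \<kappa> *s CM.cvec (\<lambda>i. g c x v (E c x i)) (\<psi> c x)" for v
        using kill[OF x, of v]
        unfolding spin_nabla_torsion_def spin_nabla_def cliff2_def vec N CM.cquad_add
          linear_scale[OF linear_matrix_action] quad
        by (simp add: algebra_simps)
    next
      show "linear (\<lambda>w. \<kappa> *s w)" by (rule linear_complex_scale)
      show "\<kappa> *s (\<gamma> i *v w) = \<gamma> i *v (\<kappa> *s w)" for i w by (rule matrix_complex_scale[symmetric])
    qed
    show ?thesis
    proof (rule killing_vanishes[OF kp])
      have "ricci LC c p e3 e3 = 4 * g c p e3 e3"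
        using assms(4) c p by (simp add: einstein_metric_def)
      then show "(\<Sum>i\<in>UNIV. curv (LC c) p (axis i 1) e3 e3 $ i) = 4"
        by (simp add: ricci_def curvature_def curv_def)
      show "z = 0 \<or> (\<forall>w. \<kappa> *s w = 0)" if "\<kappa> *s z = 0" for z
        using that by (auto simp: vec_eq_iff)
    qed
  qed
  then show ?thesis by blast
qed

end
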